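(* For every $w\in\beta\mathbb N$ the following are equivalent. (1) $w\equiv^{\mathrm s}_w 0$. (2) The relation $\equiv_w$ is an equivalence relation on $\beta\mathbb Z$. (3) The relations $\equiv_w$ and $\equiv^{\mathrm s}_w$ on $\beta\mathbb Z$ coincide. (4) The quotient $(\beta\mathbb Z,\oplus)/{\equiv^{\mathrm s}_w}$ is isomorphic to $\prod_{p\in\mathbb P}G_{p,w}$, where $G_{p,w}=\mathbb Z/p^n\mathbb Z$ if $n=\max\{k\in\mathbb N\cup\{0\}: p^k\mathbb Z\in w\}$ exists, and $G_{p,w}=\mathbb Z_p$ otherwise. (5) The quotient $(\beta\mathbb Z,\oplus)/{\equiv^{\mathrm s}_w}$, when equipped with the quotient topology, is a profinite group.
   Context: $\mathbb N=\{1,2,\dots\}$ (so $0\notin\mathbb N$), $\mathbb P$ is the set of prime natural numbers, $\mathbb Z_p$ is the additive group of $p$-adic integers. $\beta\mathbb Z$ is the Stone–Čech compactification of $\mathbb Z$, i.e. the space of ultrafilters on $\mathbb Z$; $\beta\mathbb N\subseteq\beta\mathbb Z$ consists of the ultrafilters containing $\mathbb N$; integers are identified with principal ultrafilters. For $u,v\in\beta\mathbb Z$: $A\in u\otimes v$ iff $\{x:\{y:(x,y)\in A\}\in v\}\in u$ (for $A\subseteq\mathbb Z^2$; similarly for more factors), and $u\oplus v$ is the image of $u\otimes v$ under addition, i.e. $A\in u\oplus v$ iff $\{x:\{y: x+y\in A\}\in v\}\in u$. Also $-u=\{-A:A\in u\}$ and $u\ominus v=u\oplus(-v)$. Fix an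 elementary extension ${}^{*}\mathbb Z$ of $\mathbb Z$, in the language with a symbol for every subset of every $\mathbb Z^k$, that is $\kappa$-saturated for large $\kappa$, e.g. $\kappa=(2^{\aleph_0})^+$. For a tuple $a$ in ${}^{*}\mathbb Z$ and an ultrafilter $u$ on $\mathbb Z^k$, $a\models u$ means $u=\{A\subseteq\mathbb Z^k: a\in{}^{*}A\}$. Divisibility: $a\mid b$ iff $b=ac$ for some $c$. For $w\in\beta\mathbb Z\setminus\{0\}$ and $u,v\in\beta\mathbb Z$: - $u\equiv_w v$ iff there are $d\models w$ and $(a,b)\models u\otimes v$ with $d\mid a-b$; equivalently, every set in $w$ that is upward closed under divisibility belongs to $u\ominus v$. - $u\equiv^{\mathrm s}_w v$ iff there is (equivalently, for every) $(d,a,b)\models w\otimes u\otimes v$ one has $d\mid a-b$; equivalently, $\{n\in\mathbb Z: n\mathbb Z\in u\ominus v\}\in w$. It is known that $\equiv^{\mathrm s}_w$ is always an equivalence relation compatible with $\oplus$, and that the quotient $(\beta\mathbb Z,\oplus)/{\equiv^{\mathrm s}_w}$ is a group. In (4) the isomorphism is of groups. A profinite group is a topological group whose underlying space is a Stone space (compact, Hausdorff, totally disconnected). *)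

theory Defs
  imports
    "HOL-Analysis.Analysis"
    "HOL-Library.Equipollence"
    "HOL-Computational_Algebra.Primes"
    "HOL-Algebra.Elementary_Groups"
    "HOL-Algebra.Product_Groups"
    "HOL-Algebra.Weak_Morphisms"
begin

section \<open>Ultrafilters on the integers\<close>

definition ultrafilter :: "'a set set \<Rightarrow> bool" where
  "ultrafilter u \<longleftrightarrow>
     {} \<notin> u \<and>
     (\<forall>A B. A \<in> u \<and> B \<in> u \<longrightarrow> A \<inter> B \<in> u) \<and>
     (\<forall>A B. A \<in> u \<and> A \<subseteq> B \<longrightarrow> B \<in> u) \<and>
     (\<forall>A. A \<in> u \<or> - A \<in> u)"

definition betaZ :: "int set set set" where
  "betaZ = {u. ultrafilter u}"

definition betaN :: "int set set set" where
  "betaN = {u \<in> betaZ. {n. 0 < n} \<in> u}"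

definition betaZ_topology :: "int set set topology" where
  "betaZ_topology = topology_generated_by {{u \<in> betaZ. A \<in> u} | A. True}"

definition principal_uf :: "'a \<Rightarrow> 'a set set" where
  "principal_uf x = {A. x \<in> A}"

definition tensor :: "'a set set \<Rightarrow> 'b set set \<Rightarrow> ('a \<times> 'b) set set" where
  "tensor u v = {A. {x. {y. (x, y) \<in> A} \<in> v} \<in> u}"

definition uf_add :: "int set set \<Rightarrow> int set set \<Rightarrow> int set set" where
  "uf_add u v = {A. {x. {y. x + y \<in> A} \<in> v} \<in> u}"

definition betaZ_monoid :: "int set set monoid" where
  "betaZ_monoid = \<lparr>carrier = betaZ, mult = uf_add, one = principal_uf 0\<rparr>"


section \<open>Saturated elementary extensions of the integers\<close>

text \<open>
  First-order formulas with parameters from \<open>'m\<close>, in the language with a relation symbol for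
  every subset of every \<open>\<int>\<^sup>k\<close>. Elements of \<open>\<int>\<^sup>k\<close> are lists of length \<open>k\<close>. A symbol \<open>A\<close> may be
  applied to argument lists of any length; applied to \<open>k\<close> arguments it denotes \<open>A \<inter> \<int>\<^sup>k\<close>.
\<close>

datatype 'm trm = Var nat | Param 'm

datatype (params: 'm) fm =
    FRel "int list set" "'m trm list"
  | FEq "'m trm" "'m trm"
  | FNot "'m fm"
  | FAnd "'m fm" "'m fm"
  | FEx nat "'m fm"

primrec fv_trm :: "'m trm \<Rightarrow> nat set" where
  "fv_trm (Var n) = {n}"
| "fv_trm (Param c) = {}"

primrec fv :: "'m fm \<Rightarrow> nat set" where
  "fv (FRel A ts) = (\<Union>t\<in>set ts. fv_trm t)"
| "fv (FEq s t) = fv_trm s \<union> fv_trm t"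
| "fv (FNot \<phi>) = fv \<phi>"
| "fv (FAnd \<phi> \<psi>) = fv \<phi> \<union> fv \<psi>"
| "fv (FEx n \<phi>) = fv \<phi> - {n}"

primrec val :: "(nat \<Rightarrow> 'm) \<Rightarrow> 'm trm \<Rightarrow> 'm" where
  "val e (Var n) = e n"
| "val e (Param c) = c"

primrec sat :: "(int list set \<Rightarrow> 'm list set) \<Rightarrow> (nat \<Rightarrow> 'm) \<Rightarrow> 'm fm \<Rightarrow> bool" where
  "sat I e (FRel A ts) \<longleftrightarrow> map (val e) ts \<in> I A"
| "sat I e (FEq s t) \<longleftrightarrow> val e s = val e t"
| "sat I e (FNot \<phi>) \<longleftrightarrow> \<not> sat I e \<phi>"
| "sat I e (FAnd \<phi> \<psi>) \<longleftrightarrow> sat I e \<phi> \<and> sat I e \<psi>"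
| "sat I e (FEx n \<phi>) \<longleftrightarrow> (\<exists>x. sat I (e(n := x)) \<phi>)"

text \<open>
  The structure \<open>*\<int>\<close> has universe \<open>'s\<close> and interprets the symbol \<open>A\<close> as \<open>star A\<close>;
  \<open>emb\<close> is the inclusion of \<open>\<int>\<close>.
\<close>

definition elementary_extension ::
    "(int \<Rightarrow> 's) \<Rightarrow> (int list set \<Rightarrow> 's list set) \<Rightarrow> bool" where
  "elementary_extension emb star \<longleftrightarrow>
     (\<forall>\<phi> e. sat (\<lambda>A. A) e \<phi> \<longleftrightarrow> sat star (emb \<circ> e) (map_fm emb \<phi>))"

text \<open>
  \<open>\<kappa>\<close>-saturation for \<open>\<kappa> = (2\<^bsup>\<aleph>\<^sub>0\<^esup>)\<^sup>+\<close>: every finitely satisfiable 1-type over a set of at most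
  \<open>2\<^bsup>\<aleph>\<^sub>0\<^esup>\<close> parameters is realised.
\<close>

definition saturated :: "(int list set \<Rightarrow> 's list set) \<Rightarrow> bool" where
  "saturated star \<longleftrightarrow>
     (\<forall>P \<Gamma>. P \<lesssim> (UNIV :: nat set set) \<longrightarrow>
        (\<forall>\<phi>\<in>\<Gamma>. params \<phi> \<subseteq> P \<and> fv \<phi> \<subseteq> {0}) \<longrightarrow>
        (\<forall>\<Delta>. finite \<Delta> \<and> \<Delta> \<subseteq> \<Gamma> \<longrightarrow> (\<exists>x. \<forall>\<phi>\<in>\<Delta>. sat star (\<lambda>_. x) \<phi>)) \<longrightarrow>
        (\<exists>x. \<forall>\<phi>\<in>\<Gamma>. sat star (\<lambda>_. x) \<phi>))"

text \<open>
  \<open>a \<Turnstile> t\<close> for an ultrafilter \<open>t\<close> on \<open>\<int>\<^sup>k\<close>, where \<open>enc\<close> writes the elements of \<open>\<int>\<^sup>k\<close> as lists.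
\<close>

definition realizes ::
    "(int list set \<Rightarrow> 's list set) \<Rightarrow> ('a \<Rightarrow> int list) \<Rightarrow> 's list \<Rightarrow> 'a set set \<Rightarrow> bool" where
  "realizes star enc a t \<longleftrightarrow> t = {A. a \<in> star (enc ` A)}"

text \<open>\<open>d \<bar> a - b\<close> in \<open>*\<int>\<close>: there are \<open>c, m\<close> with \<open>d c = m\<close> and \<open>m + b = a\<close>.\<close>

definition star_dvd_diff :: "(int list set \<Rightarrow> 's list set) \<Rightarrow> 's \<Rightarrow> 's \<Rightarrow> 's \<Rightarrow> bool" where
  "star_dvd_diff star d a b \<longleftrightarrow>
     (\<exists>c m. [d, c, m] \<in> star {[x, y, z] | x y z. x * y = z} \<and>
            [m, b, a] \<in> star {[x, y, z] | x y z. x + y = z})"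


section \<open>Congruence modulo an ultrafilter\<close>

definition uf_cong ::
    "(int list set \<Rightarrow> 's list set) \<Rightarrow> int set set \<Rightarrow> (int set set \<times> int set set) set" where
  "uf_cong star w =
     {(u, v). u \<in> betaZ \<and> v \<in> betaZ \<and>
        (\<exists>d a b. realizes star (\<lambda>x. [x]) [d] w \<and>
                 realizes star (\<lambda>(x, y). [x, y]) [a, b] (tensor u v) \<and>
                 star_dvd_diff star d a b)}"

definition uf_scong ::
    "(int list set \<Rightarrow> 's list set) \<Rightarrow> int set set \<Rightarrow> (int set set \<times> int set set) set" where
  "uf_scong star w =
     {(u, v). u \<in> betaZ \<and> v \<in> betaZ \<and>
        (\<exists>d a b. realizes star (\<lambda>(x, y, z). [x, y, z]) [d, a, b] (tensor w (tensor u v)) \<and>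
                 star_dvd_diff star d a b)}"


section \<open>Quotients and profinite groups\<close>

definition quotient_monoid :: "('a, 'b) monoid_scheme \<Rightarrow> ('a \<times> 'a) set \<Rightarrow> 'a set monoid" where
  "quotient_monoid M r =
     \<lparr>carrier = carrier M // r,
      mult = (\<lambda>X Y. \<Union>x\<in>X. \<Union>y\<in>Y. r `` {x \<otimes>\<^bsub>M\<^esub> y}),
      one = r `` {\<one>\<^bsub>M\<^esub>}\<rparr>"

definition quotient_topology :: "'a topology \<Rightarrow> ('a \<times> 'a) set \<Rightarrow> 'a set topology" where
  "quotient_topology X r =
     topology (\<lambda>V. V \<subseteq> topspace X // r \<and> openin X {x \<in> topspace X. r `` {x} \<in> V})"

lemma openin_quotient_topology:
  "openin (quotient_topology X r) V \<longleftrightarrow>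
     V \<subseteq> topspace X // r \<and> openin X {x \<in> topspace X. r `` {x} \<in> V}"
proof -
  have "istopology (\<lambda>V. V \<subseteq> topspace X // r \<and> openin X {x \<in> topspace X. r `` {x} \<in> V})"
    unfolding istopology_def
  proof (rule conjI; intro allI impI)
    fix S T
    assume S: "S \<subseteq> topspace X // r \<and> openin X {x \<in> topspace X. r `` {x} \<in> S}"
      and T: "T \<subseteq> topspace X // r \<and> openin X {x \<in> topspace X. r `` {x} \<in> T}"
    have "{x \<in> topspace X. r `` {x} \<in> S \<inter> T} =
        {x \<in> topspace X. r `` {x} \<in> S} \<inter> {x \<in> topspace X. r `` {x} \<in> T}"
      by auto
    with S T show "S \<inter> T \<subseteq> topspace X // r \<and> openin X {x \<in> topspace X. r `` {x} \<in> S \<inter> T}"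
      by auto
  next
    fix K
    assume K: "\<forall>V\<in>K. V \<subseteq> topspace X // r \<and> openin X {x \<in> topspace X. r `` {x} \<in> V}"
    have "{x \<in> topspace X. r `` {x} \<in> \<Union>K} = (\<Union>V\<in>K. {x \<in> topspace X. r `` {x} \<in> V})"
      by auto
    with K show "\<Union>K \<subseteq> topspace X // r \<and> openin X {x \<in> topspace X. r `` {x} \<in> \<Union>K}"
      by auto
  qed
  then show ?thesis
    by (simp add: quotient_topology_def topology_inverse')
qed

definition totally_disconnected_space :: "'a topology \<Rightarrow> bool" where
  "totally_disconnected_space X \<longleftrightarrow> (\<forall>C \<in> connected_components_of X. \<exists>x. C = {x})"

definition topological_group :: "('a, 'b) monoid_scheme \<Rightarrow> 'a topology \<Rightarrow> bool" where
  "topological_group G X \<longleftrightarrow>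
     group G \<and> topspace X = carrier G \<and>
     continuous_map (prod_topology X X) X (\<lambda>(x, y). x \<otimes>\<^bsub>G\<^esub> y) \<and>
     continuous_map X X (\<lambda>x. inv\<^bsub>G\<^esub> x)"

definition profinite_group :: "('a, 'b) monoid_scheme \<Rightarrow> 'a topology \<Rightarrow> bool" where
  "profinite_group G X \<longleftrightarrow>
     topological_group G X \<and>
     compact_space X \<and> Hausdorff_space X \<and> totally_disconnected_space X"


section \<open>The factors of the product\<close>

text \<open>\<open>\<int>\<^sub>p\<close> as the inverse limit of the groups \<open>\<int>/p\<^sup>k\<int>\<close>.\<close>

definition padic_group :: "nat \<Rightarrow> (nat \<Rightarrow> int) monoid" where
  "padic_group p =
     \<lparr>carrier = {f. \<forall>k. f k \<in> carrier (integer_mod_group (p ^ k)) \<and>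
                        f (Suc k) mod int (p ^ k) = f k},
      mult = (\<lambda>f g k. f k \<otimes>\<^bsub>integer_mod_group (p ^ k)\<^esub> g k),
      one = (\<lambda>k. \<one>\<^bsub>integer_mod_group (p ^ k)\<^esub>)\<rparr>"

definition prime_exponents :: "int set set \<Rightarrow> nat \<Rightarrow> nat set" where
  "prime_exponents w p = {k. {x. int (p ^ k) dvd x} \<in> w}"

text \<open>
  The copies along \<open>Inl\<close> and \<open>Inr\<close> only serve to give all the factors the same type.
  The set \<open>prime_exponents w p\<close> contains \<open>0\<close>, so it has a maximum iff it is finite.
\<close>

definition G_factor :: "int set set \<Rightarrow> nat \<Rightarrow> (int + (nat \<Rightarrow> int)) monoid" where
  "G_factor w p =
     (if finite (prime_exponents w p)
      then image_group Inl (integer_mod_group (p ^ Max (prime_exponents w p)))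
      else image_group Inr (padic_group p))"

end

theory Submission
  imports Defs "HOL-Number_Theory.Cong"
begin

text \<open>
  An ultrafilter \<open>u\<close> has a residue modulo each positive integer \<open>n\<close>, and \<open>u\<close>, \<open>v\<close> are strongly
  congruent modulo \<open>w\<close> iff their residues modulo \<open>n\<close> agree for \<open>w\<close>-almost all \<open>n\<close>. So the quotient
  is the group of profinite integers modulo the subgroup \<open>H\<close> of those \<open>x\<close> with \<open>n \<bar> x\<close> for
  \<open>w\<close>-almost all \<open>n\<close>. Let \<open>D\<close> be the set of positive integers dividing \<open>w\<close>. The closure of \<open>H\<close> is
  the set \<open>K\<close> of common multiples of \<open>D\<close>, and the quotient by \<open>K\<close> is the product of the local factors.
  There is a \<open>z \<in> K\<close> whose set of integer divisors is exactly \<open>D\<close>, so \<open>H = K\<close> iff \<open>D \<in> w\<close>, that is,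
  iff \<open>w\<close> is self-divisible. A Hausdorff quotient forces \<open>H\<close> to be closed. So does an isomorphism
  of abstract groups with the product of the local factors, because the product has no nonzero
  infinitely divisible element, whereas \<open>z\<close> becomes infinitely divisible modulo \<open>H\<close>. Finally,
  the weak congruence holds between \<open>w\<close> and \<open>0\<close> and between ultrafilters with equal residues; if
  \<open>w\<close> is not self-divisible, some \<open>v\<close> with the residues of \<open>w\<close> is not weakly congruent to \<open>0\<close>,
  so transitivity fails.
\<close>

section \<open>Ultrafilters\<close>

lemma ultrafilter_empty: "ultrafilter u \<Longrightarrow> {} \<notin> u"
  by (simp add: ultrafilter_def)

lemma ultrafilter_mono: "ultrafilter u \<Longrightarrow> A \<in> u \<Longrightarrow> A \<subseteq> B \<Longrightarrow> B \<in> u"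
  unfolding ultrafilter_def by blast

lemma ultrafilter_Int_iff: "ultrafilter u \<Longrightarrow> A \<inter> B \<in> u \<longleftrightarrow> A \<in> u \<and> B \<in> u"
  unfolding ultrafilter_def by (meson Int_lower1 Int_lower2)

lemma ultrafilter_Compl_iff: "ultrafilter u \<Longrightarrow> - A \<in> u \<longleftrightarrow> A \<notin> u"
  using ultrafilter_Int_iff[of u A "- A"] ultrafilter_empty[of u]
  by (auto simp: ultrafilter_def)

lemma ultrafilter_UNIV: "ultrafilter u \<Longrightarrow> UNIV \<in> u"
  using ultrafilter_Compl_iff[of u "{}"] ultrafilter_empty[of u] by simp

lemma ultrafilter_nonempty: "ultrafilter u \<Longrightarrow> A \<in> u \<Longrightarrow> \<exists>x. x \<in> A"
  using ultrafilter_empty by (metis all_not_in_conv)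

lemma ultrafilter_Collect_conj:
  "ultrafilter u \<Longrightarrow> {x. P x \<and> Q x} \<in> u \<longleftrightarrow> {x. P x} \<in> u \<and> {x. Q x} \<in> u"
  using ultrafilter_Int_iff[of u "{x. P x}" "{x. Q x}"] by (simp add: Collect_conj_eq)

lemma ultrafilter_Collect_not:
  "ultrafilter u \<Longrightarrow> {x. \<not> P x} \<in> u \<longleftrightarrow> {x. P x} \<notin> u"
  using ultrafilter_Compl_iff[of u "{x. P x}"] by (simp add: Collect_neg_eq)

lemma ultrafilter_Collect_ball:
  assumes "ultrafilter u" "finite I"
  shows "{x. \<forall>i\<in>I. P i x} \<in> u \<longleftrightarrow> (\<forall>i\<in>I. {x. P i x} \<in> u)"
  using assms(2)
  by induction (auto simp: ultrafilter_UNIV assms(1) ultrafilter_Collect_conj)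

lemma ultrafilter_Inter:
  assumes "ultrafilter u" "finite F" "F \<subseteq> u"
  shows "\<Inter>F \<in> u"
  using assms(2,3)
  by induction (auto simp: ultrafilter_UNIV assms(1) ultrafilter_Int_iff)

lemma ultrafilter_eqI: "ultrafilter u \<Longrightarrow> ultrafilter v \<Longrightarrow> u \<subseteq> v \<Longrightarrow> u = v"
  by (metis subset_antisym subsetI subsetD ultrafilter_Compl_iff)

text \<open>Zorn's lemma gives a maximal family \<open>u\<close> containing \<open>C\<close> with
  the finite intersection property. By maximality, every set outside \<open>u\<close> is disjoint
  from some finite intersection of members of \<open>u\<close>; the ultrafilter axioms
  follow.\<close>

lemma ultrafilter_exists:
  assumes fip: "\<And>F. finite F \<Longrightarrow> F \<subseteq> C \<Longrightarrow> \<Inter>F \<noteq> {}"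
  shows "\<exists>u. ultrafilter u \<and> C \<subseteq> u"
proof -
  define \<A> where "\<A> = {D. C \<subseteq> D \<and> (\<forall>F. finite F \<and> F \<subseteq> D \<longrightarrow> \<Inter>F \<noteq> {})}"
  have "C \<in> \<A>"
    using fip by (simp add: \<A>_def)
  moreover have "\<Union>K \<in> \<A>" if "K \<noteq> {}" "subset.chain \<A> K" for K
  proof -
    have "K \<subseteq> \<A>"
      using that by (simp add: subset.chain_def)
    moreover have "\<Inter>F \<noteq> {}" if F: "finite F" "F \<subseteq> \<Union>K" for F
    proof -
      obtain D where "D \<in> K" "F \<subseteq> D"
        using finite_subset_Union_chain[OF F \<open>K \<noteq> {}\<close> \<open>subset.chain \<A> K\<close>] by blast
      with \<open>K \<subseteq> \<A>\<close> F show ?thesis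
        by (auto simp: \<A>_def)
    qed
    moreover have "C \<subseteq> \<Union>K"
      using \<open>K \<noteq> {}\<close> \<open>K \<subseteq> \<A>\<close> by (force simp: \<A>_def)
    ultimately show ?thesis
      by (simp add: \<A>_def)
  qed
  ultimately have "\<exists>u\<in>\<A>. \<forall>D\<in>\<A>. u \<subseteq> D \<longrightarrow> D = u"
    by (intro subset_Zorn_nonempty) auto
  then obtain u where u: "u \<in> \<A>" and max: "\<And>D. D \<in> \<A> \<Longrightarrow> u \<subseteq> D \<Longrightarrow> D = u"
    by blast
  have fin: "\<Inter>F \<noteq> {}" if "finite F" "F \<subseteq> u" for F
    using u that by (auto simp: \<A>_def)
  have mem: "\<exists>F. finite F \<and> F \<subseteq> u \<and> A \<inter> \<Inter>F = {}" if "A \<notin> u" for A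
  proof (rule ccontr)
    assume no: "\<nexists>F. finite F \<and> F \<subseteq> u \<and> A \<inter> \<Inter>F = {}"
    have "\<Inter>F \<noteq> {}" if F: "finite F" "F \<subseteq> insert A u" for F
    proof -
      have "finite (F - {A})" "F - {A} \<subseteq> u"
        using F by auto
      with no have "A \<inter> \<Inter>(F - {A}) \<noteq> {}"
        by metis
      moreover have "A \<inter> \<Inter>(F - {A}) \<subseteq> \<Inter>F"
        by auto
      ultimately show ?thesis
        by (metis subset_empty)
    qed
    then have "insert A u \<in> \<A>"
      using u by (auto simp: \<A>_def)
    then show False
      using max \<open>A \<notin> u\<close> by blast
  qed
  have dich: "A \<in> u \<or> - A \<in> u" for A
  proof (rule ccontr)
    assume "\<not> ?thesis"
    then obtain F F' where "finite F" "F \<subseteq> u" "A \<inter> \<Inter>F = {}"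
        "finite F'" "F' \<subseteq> u" "- A \<inter> \<Inter>F' = {}"
      using mem[of A] mem[of "- A"] by metis
    have "\<Inter>(F \<union> F') = {}"
      using \<open>A \<inter> \<Inter>F = {}\<close> \<open>- A \<inter> \<Inter>F' = {}\<close> by auto
    then show False
      using fin[of "F \<union> F'"] \<open>finite F\<close> \<open>F \<subseteq> u\<close> \<open>finite F'\<close> \<open>F' \<subseteq> u\<close> by simp
  qed
  have closed: "B \<in> u" if "finite F" "F \<subseteq> u" "\<Inter>F \<subseteq> B" for F B
  proof (rule ccontr)
    assume "B \<notin> u"
    then have "\<Inter>(insert (- B) F) \<noteq> {}"
      using fin[of "insert (- B) F"] dich[of B] that by simp
    then show False
      using that(3) by auto
  qed
  have "ultrafilter u"
    unfolding ultrafilter_def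
  proof (intro conjI allI impI)
    show "{} \<notin> u"
      using fin[of "{{}}"] by auto
    show "A \<inter> B \<in> u" if "A \<in> u \<and> B \<in> u" for A B
      using closed[of "{A, B}"] that by auto
    show "B \<in> u" if "A \<in> u \<and> A \<subseteq> B" for A B
      using closed[of "{A}"] that by auto
  qed (rule dich)
  moreover have "C \<subseteq> u"
    using u by (simp add: \<A>_def)
  ultimately show ?thesis
    by blast
qed

text \<open>Sets that lie in \<open>V k\<close> for all large \<open>k\<close> have the finite
  intersection property, and an ultrafilter containing them is a cluster point of the sequence. The
  last property is the second one applied to the complement of \<open>A\<close>.\<close>

lemma ultrafilter_limit:
  assumes "\<And>k::nat. ultrafilter (V k)"
  obtains u where "ultrafilter u"
    and "\<And>A. eventually (\<lambda>k. A \<in> V k) sequentially \<Longrightarrow> A \<in> u"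
    and "\<And>A. A \<in> u \<Longrightarrow> \<exists>k. A \<in> V k"
proof -
  define C where "C = {A. eventually (\<lambda>k. A \<in> V k) sequentially}"
  have "\<Inter>F \<noteq> {}" if F: "finite F" "F \<subseteq> C" for F
  proof -
    have "eventually (\<lambda>k. \<forall>A\<in>F. A \<in> V k) sequentially"
      using F by (intro eventually_ball_finite) (auto simp: C_def)
    then obtain k where "\<forall>A\<in>F. A \<in> V k"
      by (auto simp: eventually_sequentially)
    then have "\<Inter>F \<in> V k"
      using F assms by (intro ultrafilter_Inter) auto
    then show ?thesis
      using assms ultrafilter_empty by metis
  qed
  then obtain u where u: "ultrafilter u" "C \<subseteq> u"
    using ultrafilter_exists by blast
  have "\<exists>k. A \<in> V k" if "A \<in> u" for A
  proof (rule ccontr)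
    assume "\<nexists>k. A \<in> V k"
    then have "- A \<in> C"
      by (simp add: C_def ultrafilter_Compl_iff assms)
    then show False
      using u that ultrafilter_Compl_iff by blast
  qed
  with u that show ?thesis
    by (auto simp: C_def)
qed

section \<open>Principal ultrafilters, tensor products and images\<close>

lemma ultrafilter_principal: "ultrafilter (principal_uf x)"
  by (auto simp: ultrafilter_def principal_uf_def)

lemma ultrafilter_tensor:
  assumes u: "ultrafilter u" and v: "ultrafilter v"
  shows "ultrafilter (tensor u v)"
  unfolding ultrafilter_def[of "tensor u v"]
proof (intro conjI allI impI)
  show "{} \<notin> tensor u v"
    using u v by (simp add: tensor_def ultrafilter_empty)
  show "A \<inter> B \<in> tensor u v" if "A \<in> tensor u v \<and> B \<in> tensor u v" for A B
    using that u v by (simp add: tensor_def ultrafilter_Collect_conj)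
  show "B \<in> tensor u v" if "A \<in> tensor u v \<and> A \<subseteq> B" for A B
  proof -
    have "{y. (x, y) \<in> B} \<in> v" if "{y. (x, y) \<in> A} \<in> v" for x
      using that \<open>A \<in> tensor u v \<and> A \<subseteq> B\<close> by (blast intro: ultrafilter_mono[OF v])
    then show ?thesis
      using that unfolding tensor_def by (blast intro: ultrafilter_mono[OF u])
  qed
  show "A \<in> tensor u v \<or> - A \<in> tensor u v" for A
    using u v by (simp add: tensor_def ultrafilter_Collect_not)
qed

definition uf_image :: "('a \<Rightarrow> 'b) \<Rightarrow> 'a set set \<Rightarrow> 'b set set" where
  "uf_image f u = {A. f -` A \<in> u}"

lemma ultrafilter_image:
  assumes u: "ultrafilter u"
  shows "ultrafilter (uf_image f u)"
  unfolding ultrafilter_def[of "uf_image f u"]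
proof (intro conjI allI impI)
  show "B \<in> uf_image f u" if "A \<in> uf_image f u \<and> A \<subseteq> B" for A B
    using that unfolding uf_image_def by (blast intro: ultrafilter_mono[OF u])
qed (use u in \<open>simp_all add: uf_image_def ultrafilter_Int_iff vimage_Compl
    ultrafilter_Compl_iff ultrafilter_empty\<close>)

lemma uf_add_eq_image: "uf_add u v = uf_image (\<lambda>(x, y). x + y) (tensor u v)"
  by (simp add: uf_add_def uf_image_def tensor_def)

lemma betaZ_iff: "u \<in> betaZ \<longleftrightarrow> ultrafilter u"
  by (simp add: betaZ_def)

lemma uf_add_in_betaZ: "u \<in> betaZ \<Longrightarrow> v \<in> betaZ \<Longrightarrow> uf_add u v \<in> betaZ"
  by (simp add: betaZ_iff uf_add_eq_image ultrafilter_image ultrafilter_tensor)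

lemma principal_in_betaZ: "principal_uf x \<in> betaZ"
  by (simp add: betaZ_iff ultrafilter_principal)

lemma uf_image_in_betaZ: "u \<in> betaZ \<Longrightarrow> uf_image f u \<in> betaZ"
  by (simp add: betaZ_iff ultrafilter_image)

section \<open>Residues of ultrafilters\<close>

text \<open>For \<open>n > 0\<close> exactly one residue qualifies. For \<open>n = 0\<close> the set
  is \<open>{r}\<close>, so no \<open>r\<close> qualifies unless \<open>u\<close> is principal;
  hence the assumption \<open>0 < n\<close> in many lemmas.\<close>

definition res :: "int set set \<Rightarrow> int \<Rightarrow> int" where
  "res u n = (THE r. {x. x mod n = r} \<in> u)"

lemma res_eqI:
  assumes u: "u \<in> betaZ" and A: "A \<in> u" and "\<And>x. x \<in> A \<Longrightarrow> x mod n = r"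
  shows "res u n = r"
  unfolding res_def
proof (rule the_equality)
  have uf: "ultrafilter u"
    using u by (simp add: betaZ_iff)
  then show *: "{x. x mod n = r} \<in> u"
    using A assms(3) by (auto elim!: ultrafilter_mono)
  fix s
  assume "{x. x mod n = s} \<in> u"
  with * uf have "{x. x mod n = r \<and> x mod n = s} \<in> u"
    by (simp add: ultrafilter_Collect_conj)
  then show "s = r"
    using ultrafilter_nonempty[OF uf] by fastforce
qed

lemma res_mem:
  assumes u: "u \<in> betaZ" and n: "0 < n"
  shows "{x. x mod n = res u n} \<in> u"
proof -
  have uf: "ultrafilter u"
    using u by (simp add: betaZ_iff)
  have "\<exists>r\<in>{0..<n}. {x. x mod n = r} \<in> u"
  proof (rule ccontr)
    assume "\<not> ?thesis"
    then have "{x. \<forall>r\<in>{0..<n}. x mod n \<noteq> r} \<in> u"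
      using uf by (simp add: ultrafilter_Collect_ball ultrafilter_Collect_not)
    then obtain x where "\<forall>r\<in>{0..<n}. x mod n \<noteq> r"
      using ultrafilter_nonempty[OF uf] by fastforce
    then show False
      using n by auto
  qed
  then obtain r where "{x. x mod n = r} \<in> u"
    by blast
  moreover from this have "res u n = r"
    using res_eqI[OF u] by blast
  ultimately show ?thesis
    by simp
qed

lemma res_eq_iff:
  "u \<in> betaZ \<Longrightarrow> 0 < n \<Longrightarrow> res u n = r \<longleftrightarrow> {x. x mod n = r} \<in> u"
  using res_mem res_eqI by blast

lemma res_bounds:
  assumes "u \<in> betaZ" "0 < n"
  shows "0 \<le> res u n" "res u n < n"
proof -
  obtain x where "x mod n = res u n"
    using res_mem[OF assms] ultrafilter_nonempty[of u] assms(1) by (fastforce simp: betaZ_iff)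
  then show "0 \<le> res u n" "res u n < n"
    using assms(2) by (metis pos_mod_sign, metis pos_mod_bound)
qed

lemma res_mod_self: "u \<in> betaZ \<Longrightarrow> 0 < n \<Longrightarrow> res u n mod n = res u n"
  using res_bounds[of u n] by simp

text \<open>This compatibility makes the residues of \<open>u\<close> at positive moduli a profinite
  integer.\<close>

lemma res_mod_dvd:
  assumes "u \<in> betaZ" "0 < n" "m dvd n"
  shows "res u n mod m = res u m"
  using assms(3) by (intro res_eqI[OF assms(1) res_mem[OF assms(1,2)], symmetric])
    (auto simp: mod_mod_cancel dest: sym)

lemma res_zero_iff: "u \<in> betaZ \<Longrightarrow> 0 < n \<Longrightarrow> res u n = 0 \<longleftrightarrow> {x. n dvd x} \<in> u"
  by (simp add: res_eq_iff dvd_eq_mod_eq_0)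

lemma res_zero_dvd: "u \<in> betaZ \<Longrightarrow> 0 < n \<Longrightarrow> res u n = 0 \<Longrightarrow> m dvd n \<Longrightarrow> res u m = 0"
  using res_mod_dvd[of u n m] by simp

lemma res_principal: "res (principal_uf x) n = x mod n"
  by (rule res_eqI[OF principal_in_betaZ, of "{x}"]) (auto simp: principal_uf_def)

lemma res_image:
  assumes "u \<in> betaZ" "A \<in> u" "\<And>x. x \<in> A \<Longrightarrow> f x mod n = r"
  shows "res (uf_image f u) n = r"
proof (rule res_eqI[OF uf_image_in_betaZ[OF assms(1)], of "{x. x mod n = r}"])
  show "{x. x mod n = r} \<in> uf_image f u"
    using assms by (auto simp: uf_image_def betaZ_iff elim!: ultrafilter_mono)
qed auto

lemma tensor_rectangle:
  assumes "ultrafilter u" "ultrafilter v" "A \<in> u" "B \<in> v"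
  shows "A \<times> B \<in> tensor u v"
proof -
  have "{x. {y. (x, y) \<in> A \<times> B} \<in> v} \<supseteq> A"
    using assms(4) by auto
  then show ?thesis
    using assms(1,3) ultrafilter_mono by (fastforce simp: tensor_def)
qed

text \<open>The sum is constant modulo \<open>n\<close> on a rectangle of residue classes, and such
  a rectangle lies in the tensor product. Residues thus do not see the order of the
  summands.\<close>

lemma res_add:
  assumes "u \<in> betaZ" "v \<in> betaZ" "0 < n"
  shows "res (uf_add u v) n = (res u n + res v n) mod n"
proof (rule res_eqI[OF uf_add_in_betaZ[OF assms(1,2)]])
  let ?A = "{x. x mod n = res u n} \<times> {y. y mod n = res v n}"
  have "?A \<in> tensor u v"
    using assms by (intro tensor_rectangle res_mem) (auto simp: betaZ_iff)
  moreover have "?A \<subseteq> (\<lambda>(x, y). x + y) -` {z. z mod n = (res u n + res v n) mod n}"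
    by (auto simp: mod_simps dest!: sym[of _ "res u n"] sym[of _ "res v n"])
  ultimately show "{z. z mod n = (res u n + res v n) mod n} \<in> uf_add u v"
    using assms ultrafilter_mono[OF ultrafilter_tensor]
    by (fastforce simp: uf_add_eq_image uf_image_def betaZ_iff)
qed auto

definition uf_neg :: "int set set \<Rightarrow> int set set" where
  "uf_neg u = uf_image uminus u"

lemma uf_neg_in_betaZ: "u \<in> betaZ \<Longrightarrow> uf_neg u \<in> betaZ"
  by (simp add: uf_neg_def uf_image_in_betaZ)

lemma res_neg:
  assumes "u \<in> betaZ" "0 < n"
  shows "res (uf_neg u) n = (- res u n) mod n"
  unfolding uf_neg_def
  by (rule res_image[OF assms(1) res_mem[OF assms]])
    (auto simp: mod_simps dest!: sym[of _ "res u n"])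

text \<open>For a fixed modulus, the condition has a constant truth value on the rectangle of
  residue classes. This is how divisibility turns into equality of residues.\<close>

lemma tensor_dvd_diff_iff:
  assumes "u \<in> betaZ" "v \<in> betaZ" "0 < n"
  shows "{(x, y). n dvd x - y} \<in> tensor u v \<longleftrightarrow> res u n = res v n"
proof -
  let ?A = "{x. x mod n = res u n} \<times> {y. y mod n = res v n}"
  have uf: "ultrafilter (tensor u v)"
    using assms by (simp add: ultrafilter_tensor betaZ_iff)
  have A: "?A \<in> tensor u v"
    using assms by (intro tensor_rectangle res_mem) (auto simp: betaZ_iff)
  show ?thesis
  proof
    assume "{(x, y). n dvd x - y} \<in> tensor u v"
    then have "?A \<inter> {(x, y). n dvd x - y} \<in> tensor u v"
      using A uf by (simp add: ultrafilter_Int_iff)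
    then obtain x y where "(x, y) \<in> ?A \<inter> {(x, y). n dvd x - y}"
      using ultrafilter_nonempty[OF uf] by (metis surj_pair)
    then show "res u n = res v n"
      by (auto simp: mod_eq_dvd_iff[symmetric])
  next
    assume "res u n = res v n"
    then have "?A \<subseteq> {(x, y). n dvd x - y}"
      by (auto simp: mod_eq_dvd_iff[symmetric])
    then show "{(x, y). n dvd x - y} \<in> tensor u v"
      using A uf ultrafilter_mono by blast
  qed
qed

text \<open>A cluster point of an integer sequence. Every residue that the sequence eventually has
  is inherited by \<open>u\<close>, so profinite limits are realised by ultrafilters.\<close>

lemma uf_of_sequence:
  fixes x :: "nat \<Rightarrow> int"
  obtains u where "u \<in> betaZ"
    and "\<And>A. eventually (\<lambda>k. x k \<in> A) sequentially \<Longrightarrow> A \<in> u"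
proof -
  obtain u where "ultrafilter u"
    "\<And>A. eventually (\<lambda>k. A \<in> principal_uf (x k)) sequentially \<Longrightarrow> A \<in> u"
    using ultrafilter_limit[of "\<lambda>k. principal_uf (x k)"] ultrafilter_principal by metis
  then show ?thesis
    using that[of u] by (simp add: betaZ_iff principal_uf_def)
qed

section \<open>Realising ultrafilters in the elementary extension\<close>

abbreviation FAll :: "nat \<Rightarrow> 'm fm \<Rightarrow> 'm fm" where
  "FAll n \<phi> \<equiv> FNot (FEx n (FNot \<phi>))"

abbreviation FImp :: "'m fm \<Rightarrow> 'm fm \<Rightarrow> 'm fm" where
  "FImp \<phi> \<psi> \<equiv> FNot (FAnd \<phi> (FNot \<psi>))"

abbreviation FIff :: "'m fm \<Rightarrow> 'm fm \<Rightarrow> 'm fm" where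
  "FIff \<phi> \<psi> \<equiv> FAnd (FImp \<phi> \<psi>) (FImp \<psi> \<phi>)"

section \<open>Types of triples and transfer\<close>

lemma elementary_transfer:
  assumes "elementary_extension emb star" "sat (\<lambda>A. A) e \<phi>"
  shows "sat star (emb \<circ> e) (map_fm emb \<phi>)"
  using assms by (simp add: elementary_extension_def)

lemma triple_in_image: "[x, y, z] \<in> (\<lambda>(x, y, z). [x, y, z]) ` A \<longleftrightarrow> (x, y, z) \<in> A"
  by (auto simp: image_iff split_beta) force

lemma pair_in_image: "[x, y] \<in> (\<lambda>(x, y). [x, y]) ` A \<longleftrightarrow> (x, y) \<in> A"
  by (auto simp: image_iff split_beta) force

lemma singleton_in_image: "[x] \<in> (\<lambda>x. [x]) ` A \<longleftrightarrow> x \<in> A"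
  by auto

text \<open>Both congruences concern \<open>d\<close>, \<open>a\<close> and \<open>b\<close>
  jointly. A single ultrafilter on triples records all that matters: the types of \<open>d\<close>
  and of \<open>(a, b)\<close> are its images under \<open>fst\<close> and
  \<open>snd\<close>.\<close>

definition triple_type ::
    "(int list set \<Rightarrow> 's list set) \<Rightarrow> 's \<Rightarrow> 's \<Rightarrow> 's \<Rightarrow> (int \<times> int \<times> int) set set" where
  "triple_type star d a b = {A. [d, a, b] \<in> star ((\<lambda>(x, y, z). [x, y, z]) ` A)}"

context
  fixes emb :: "int \<Rightarrow> 's" and star :: "int list set \<Rightarrow> 's list set"
  assumes elem: "elementary_extension emb star"
begin

lemma ultrafilter_triple_type: "ultrafilter (triple_type star d a b)"
proof -
  let ?V = "[Var 0, Var 1, Var 2] :: int trm list"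
  let ?e = "(\<lambda>(x, y, z). [x, y, z]) :: int \<times> int \<times> int \<Rightarrow> int list"
  have Int: "[d, a, b] \<in> star (?e ` (A \<inter> B)) \<longleftrightarrow>
      [d, a, b] \<in> star (?e ` A) \<and> [d, a, b] \<in> star (?e ` B)" for A B
    \<comment> \<open>The transferred formula is a sentence, so the assignment is arbitrary.\<close>
    using elementary_transfer[OF elem, of undefined
        "FAll 0 (FAll 1 (FAll 2 (FIff (FRel (?e ` (A \<inter> B)) ?V)
           (FAnd (FRel (?e ` A) ?V) (FRel (?e ` B) ?V)))))"]
    by (simp add: triple_in_image pair_in_image singleton_in_image) blast
  have Compl: "[d, a, b] \<in> star (?e ` (- A)) \<longleftrightarrow> [d, a, b] \<notin> star (?e ` A)" for A
    using elementary_transfer[OF elem, of undefined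
        "FAll 0 (FAll 1 (FAll 2 (FIff (FRel (?e ` (- A)) ?V) (FNot (FRel (?e ` A) ?V)))))"]
    by (simp add: triple_in_image pair_in_image singleton_in_image) blast
  have "[d, a, b] \<notin> star (?e ` {})"
    using Int[of UNIV "- UNIV"] Compl[of UNIV] by simp
  moreover have "[d, a, b] \<in> star (?e ` B)" if "[d, a, b] \<in> star (?e ` A)" "A \<subseteq> B" for A B
    using Int[of A B] that by (simp add: Int_absorb2)
  ultimately show ?thesis
    unfolding ultrafilter_def triple_type_def mem_Collect_eq Int Compl by (auto simp del: image_empty)
qed

lemma dvd_diff_in_triple_type:
  "{(n, x, y). n dvd x - y} \<in> triple_type star d a b \<longleftrightarrow> star_dvd_diff star d a b"
proof -
  let ?e = "(\<lambda>(x, y, z). [x, y, z]) :: int \<times> int \<times> int \<Rightarrow> int list"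
  have "n dvd x - y \<longleftrightarrow> (\<exists>c m. n * c = m \<and> m + y = x)" for n x y :: int
    by (auto simp: dvd_def algebra_simps)
  then show ?thesis
    using elementary_transfer[OF elem, of undefined
        "FAll 0 (FAll 1 (FAll 2 (FIff (FRel (?e ` {(n, x, y). n dvd x - y}) [Var 0, Var 1, Var 2])
           (FEx 3 (FEx 4 (FAnd (FRel {[x, y, z] | x y z. x * y = z} [Var 0, Var 3, Var 4])
             (FRel {[x, y, z] | x y z. x + y = z} [Var 4, Var 2, Var 1])))))))"]
    by (simp add: triple_in_image triple_type_def star_dvd_diff_def) blast
qed

lemma realizes_fst:
  "realizes star (\<lambda>x. [x]) [d] t \<longleftrightarrow> t = uf_image fst (triple_type star d a b)"
proof -
  let ?e = "(\<lambda>(x, y, z). [x, y, z]) :: int \<times> int \<times> int \<Rightarrow> int list"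
  have "[d] \<in> star ((\<lambda>x. [x]) ` A) \<longleftrightarrow> [d, a, b] \<in> star (?e ` (fst -` A))" for A
    using elementary_transfer[OF elem, of undefined
        "FAll 0 (FAll 1 (FAll 2 (FIff (FRel ((\<lambda>x. [x]) ` A) [Var 0])
           (FRel (?e ` (fst -` A)) [Var 0, Var 1, Var 2]))))"]
    by (simp add: triple_in_image pair_in_image singleton_in_image) blast
  then show ?thesis
    by (simp add: realizes_def uf_image_def triple_type_def)
qed

lemma realizes_snd:
  "realizes star (\<lambda>(x, y). [x, y]) [a, b] t \<longleftrightarrow> t = uf_image snd (triple_type star d a b)"
proof -
  let ?e = "(\<lambda>(x, y, z). [x, y, z]) :: int \<times> int \<times> int \<Rightarrow> int list"
  have "[a, b] \<in> star ((\<lambda>(x, y). [x, y]) ` A) \<longleftrightarrow> [d, a, b] \<in> star (?e ` (snd -` A))" for A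
    using elementary_transfer[OF elem, of undefined
        "FAll 0 (FAll 1 (FAll 2 (FIff (FRel ((\<lambda>(x, y). [x, y]) ` A) [Var 1, Var 2])
           (FRel (?e ` (snd -` A)) [Var 0, Var 1, Var 2]))))"]
    by (simp add: triple_in_image pair_in_image singleton_in_image) blast
  then show ?thesis
    by (simp add: realizes_def uf_image_def triple_type_def)
qed

text \<open>Saturation is about types in one variable, so a triple is coded by a single integer.\<close>

lemma ultrafilter_realized:
  assumes saturated: "saturated star" and T: "ultrafilter T"
  shows "\<exists>d a b. triple_type star d a b = T"
proof -
  define f :: "int \<Rightarrow> int \<times> int \<times> int" where "f = from_nat \<circ> nat"
  let ?e = "(\<lambda>(x, y, z). [x, y, z]) :: int \<times> int \<times> int \<Rightarrow> int list"
  have f_surj: "\<exists>i. f i = t" for t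
    by (rule exI[of _ "int (to_nat t)"]) (simp add: f_def)
  \<comment> \<open>An element satisfies these formulas iff it is a code of a triple of type
    \<open>T\<close>. They have no parameters, and finitely many of them are satisfied by a standard
    integer.\<close>
  define \<Gamma> :: "'s fm set" where
    "\<Gamma> = (\<lambda>A. FRel ((\<lambda>i. [i]) ` (f -` A)) [Var 0]) ` T"
  have realized: "\<exists>x. \<forall>\<phi>\<in>\<Delta>. sat star (\<lambda>_. x) \<phi>" if \<Delta>: "finite \<Delta>" "\<Delta> \<subseteq> \<Gamma>" for \<Delta>
  proof -
    obtain F where F: "F \<subseteq> T" "finite F" and
        \<Delta>_eq: "\<Delta> = (\<lambda>A. FRel ((\<lambda>i. [i]) ` (f -` A)) [Var 0]) ` F"
      using \<Delta> unfolding \<Gamma>_def by (meson finite_subset_image)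
    have "\<Inter>F \<in> T"
      using F T by (simp add: ultrafilter_Inter)
    then obtain i where i: "f i \<in> \<Inter>F"
      using f_surj ultrafilter_nonempty[OF T] by metis
    have "[emb i] \<in> star ((\<lambda>i. [i]) ` (f -` A))" if "A \<in> F" for A
      using elementary_transfer[OF elem, of "\<lambda>_. i" "FRel ((\<lambda>i. [i]) ` (f -` A)) [Var 0]"] i that
      by auto
    then show ?thesis
      by (auto simp: \<Delta>_eq)
  qed
  have "\<exists>x. \<forall>\<phi>\<in>\<Gamma>. sat star (\<lambda>_. x) \<phi>"
  proof (rule saturated[unfolded saturated_def, THEN spec[of _ "{}"], THEN spec[of _ \<Gamma>],
        THEN mp, THEN mp, THEN mp])
    show "({} :: 's set) \<lesssim> (UNIV :: nat set set)"
      by (simp add: lepoll_def)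
    show "\<forall>\<phi>\<in>\<Gamma>. params \<phi> \<subseteq> {} \<and> fv \<phi> \<subseteq> {0}"
      by (auto simp: \<Gamma>_def)
  qed (use realized in \<open>iprover\<close>)
  then obtain x where x: "\<forall>\<phi>\<in>\<Gamma>. sat star (\<lambda>_. x) \<phi>"
    by blast
  \<comment> \<open>The graph of the decoding map as a 4-ary relation. Transfer of its totality
    decodes the nonstandard \<open>x\<close> into a triple.\<close>
  define G where "G = {[i, p, q, r] | i p q r. f i = (p, q, r)}"
  have G_mem: "[i, p, q, r] \<in> G \<longleftrightarrow> f i = (p, q, r)" for i p q r
    by (simp add: G_def)
  have "\<exists>p q r. f i = (p, q, r)" for i
    by (metis surj_pair)
  then have "\<exists>d a b. [x, d, a, b] \<in> star G"
    using elementary_transfer[OF elem, of undefined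
        "FAll 0 (FEx 1 (FEx 2 (FEx 3 (FRel G [Var 0, Var 1, Var 2, Var 3]))))"]
    by (simp add: G_mem)
  then obtain d a b where dab: "[x, d, a, b] \<in> star G"
    by blast
  have "A \<in> triple_type star d a b" if "A \<in> T" for A
  proof -
    have "[x] \<in> star ((\<lambda>i. [i]) ` (f -` A))"
      using x that by (auto simp: \<Gamma>_def)
    moreover have "(p, q, r) \<in> A" if "f i = (p, q, r)" "f i \<in> A" for i p q r
      using that by simp
    ultimately show ?thesis
      using dab elementary_transfer[OF elem, of undefined
          "FAll 0 (FAll 1 (FAll 2 (FAll 3 (FImp (FAnd (FRel G [Var 0, Var 1, Var 2, Var 3])
             (FRel ((\<lambda>i. [i]) ` (f -` A)) [Var 0]))
             (FRel (?e ` A) [Var 1, Var 2, Var 3])))))"]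
      by (simp add: triple_type_def G_mem triple_in_image singleton_in_image) metis
  qed
  then have "T = triple_type star d a b"
    using T ultrafilter_triple_type ultrafilter_eqI by blast
  then show ?thesis
    by blast
qed

text \<open>By saturation, the types of triples are exactly the ultrafilters on triples. So the
  extension can be eliminated: \<open>U\<close> is the type of \<open>(d, a, b)\<close>, with
  prescribed images and concentrated on the divisibility relation.\<close>

lemma uf_cong_iff:
  assumes "saturated star"
  shows "(u, v) \<in> uf_cong star w \<longleftrightarrow> u \<in> betaZ \<and> v \<in> betaZ \<and>
    (\<exists>U. ultrafilter U \<and> uf_image fst U = w \<and> uf_image snd U = tensor u v \<and>
         {(n, x, y). n dvd x - y} \<in> U)"
    (is "_ \<longleftrightarrow> ?R")
proof
  assume "(u, v) \<in> uf_cong star w"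
  then obtain d a b where *: "u \<in> betaZ" "v \<in> betaZ" "realizes star (\<lambda>x. [x]) [d] w"
      "realizes star (\<lambda>(x, y). [x, y]) [a, b] (tensor u v)" "star_dvd_diff star d a b"
    by (auto simp: uf_cong_def)
  then show ?R
    using realizes_fst[of d w a b] realizes_snd[of a b "tensor u v" d]
    by (intro conjI exI[of _ "triple_type star d a b"])
      (auto simp: ultrafilter_triple_type dvd_diff_in_triple_type)
next
  assume ?R
  then obtain U where U: "u \<in> betaZ" "v \<in> betaZ" "ultrafilter U" "uf_image fst U = w"
      "uf_image snd U = tensor u v" "{(n, x, y). n dvd x - y} \<in> U"
    by blast
  then obtain d a b where "triple_type star d a b = U"
    using ultrafilter_realized assms by blast
  with U have "realizes star (\<lambda>x. [x]) [d] w"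
      "realizes star (\<lambda>(x, y). [x, y]) [a, b] (tensor u v)" "star_dvd_diff star d a b"
    using realizes_fst[of d w a b] realizes_snd[of a b "tensor u v" d]
      dvd_diff_in_triple_type[of d a b] by simp_all
  with U show "(u, v) \<in> uf_cong star w"
    unfolding uf_cong_def by blast
qed

text \<open>Here the whole type of the triple is prescribed, so divisibility is decided by that
  type, and saturation supplies a realisation.\<close>

lemma uf_scong_iff_tensor:
  assumes "saturated star" "w \<in> betaZ"
  shows "(u, v) \<in> uf_scong star w \<longleftrightarrow> u \<in> betaZ \<and> v \<in> betaZ \<and>
    {(n, x, y). n dvd x - y} \<in> tensor w (tensor u v)"
proof -
  have realizes: "realizes star (\<lambda>(x, y, z). [x, y, z]) [d, a, b] t \<longleftrightarrow> t = triple_type star d a b"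
    for d a b t
    by (simp add: realizes_def triple_type_def)
  have "\<exists>d a b. tensor w (tensor u v) = triple_type star d a b" if "u \<in> betaZ" "v \<in> betaZ"
    using ultrafilter_realized[OF assms(1), of "tensor w (tensor u v)"] that assms(2)
    by (auto simp: betaZ_iff ultrafilter_tensor dest: sym)
  then show ?thesis
    unfolding uf_scong_def realizes by (auto simp flip: dvd_diff_in_triple_type)
qed

end

section \<open>The strong congruence in terms of residues\<close>

definition res_cong :: "int set set \<Rightarrow> (int set set \<times> int set set) set" where
  "res_cong w = {(u, v). u \<in> betaZ \<and> v \<in> betaZ \<and> {n. 0 < n \<and> res u n = res v n} \<in> w}"

text \<open>The pivot of the proof: all five conditions are compared with it.\<close>

definition self_divisible :: "int set set \<Rightarrow> bool" where
  "self_divisible w \<longleftrightarrow> {n. 0 < n \<and> res w n = 0} \<in> w"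

lemma betaN_iff: "w \<in> betaN \<longleftrightarrow> ultrafilter w \<and> {n. 0 < n} \<in> w"
  by (simp add: betaN_def betaZ_iff)

lemma uf_scong_eq_res_cong:
  assumes "elementary_extension emb star" "saturated star" and w: "w \<in> betaN"
  shows "uf_scong star w = res_cong w"
proof -
  have uf: "ultrafilter w" and pos: "{n. 0 < n} \<in> w"
    using w by (auto simp: betaN_iff)
  have "{(n, x, y). n dvd x - y} \<in> tensor w (tensor u v) \<longleftrightarrow>
      {n. 0 < n \<and> res u n = res v n} \<in> w" if "u \<in> betaZ" "v \<in> betaZ" for u v
  proof -
    have "{(n, x, y). n dvd x - y} \<in> tensor w (tensor u v) \<longleftrightarrow>
        {n. {(x, y). n dvd x - y} \<in> tensor u v} \<in> w"
      by (simp add: tensor_def[of w])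
    also have "\<dots> \<longleftrightarrow> {n. 0 < n \<and> {(x, y). n dvd x - y} \<in> tensor u v} \<in> w"
      using uf pos by (simp add: ultrafilter_Collect_conj)
    also have "{n. 0 < n \<and> {(x, y). n dvd x - y} \<in> tensor u v} = {n. 0 < n \<and> res u n = res v n}"
      using that by (auto simp: tensor_dvd_diff_iff)
    finally show ?thesis .
  qed
  moreover have "w \<in> betaZ"
    using uf by (simp add: betaZ_iff)
  ultimately show ?thesis
    using uf_scong_iff_tensor[OF assms(1,2)] by (auto simp: res_cong_def)
qed

lemma res_cong_iff:
  "(u, v) \<in> res_cong w \<longleftrightarrow> u \<in> betaZ \<and> v \<in> betaZ \<and> {n. 0 < n \<and> res u n = res v n} \<in> w"
  by (simp add: res_cong_def)

lemma res_congI: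
  assumes "w \<in> betaN" "u \<in> betaZ" "v \<in> betaZ" "\<And>n. 0 < n \<Longrightarrow> res u n = res v n"
  shows "(u, v) \<in> res_cong w"
proof -
  have "{n. 0 < n \<and> res u n = res v n} = {n. 0 < n}"
    using assms(4) by auto
  then show ?thesis
    using assms by (simp add: res_cong_iff betaN_iff)
qed

lemma equiv_res_cong:
  assumes "w \<in> betaN"
  shows "equiv betaZ (res_cong w)"
proof (rule equivI)
  show "res_cong w \<subseteq> betaZ \<times> betaZ"
    by (auto simp: res_cong_def)
  show "refl_on betaZ (res_cong w)"
    using assms by (auto simp: refl_on_def intro: res_congI)
  show "sym (res_cong w)"
    by (auto simp: sym_def res_cong_iff eq_commute)
  show "trans (res_cong w)"
  proof (rule transI)
    fix u v t
    assume *: "(u, v) \<in> res_cong w" "(v, t) \<in> res_cong w"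
    have uf: "ultrafilter w"
      using assms by (simp add: betaN_iff)
    then have "{n. (0 < n \<and> res u n = res v n) \<and> (0 < n \<and> res v n = res t n)} \<in> w"
      using * by (subst ultrafilter_Collect_conj) (auto simp: res_cong_iff)
    then have "{n. 0 < n \<and> res u n = res t n} \<in> w"
      by (rule ultrafilter_mono[OF uf]) auto
    then show "(u, t) \<in> res_cong w"
      using * by (simp add: res_cong_iff)
  qed
qed

lemma res_cong_add:
  assumes "w \<in> betaN" "(u, u') \<in> res_cong w" "(v, v') \<in> res_cong w"
  shows "(uf_add u v, uf_add u' v') \<in> res_cong w"
proof -
  have uf: "ultrafilter w"
    using assms by (simp add: betaN_iff)
  then have "{n. (0 < n \<and> res u n = res u' n) \<and> (0 < n \<and> res v n = res v' n)} \<in> w"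
    using assms by (subst ultrafilter_Collect_conj) (auto simp: res_cong_iff)
  then have "{n. 0 < n \<and> res (uf_add u v) n = res (uf_add u' v') n} \<in> w"
    by (rule ultrafilter_mono[OF uf]) (use assms in \<open>auto simp: res_cong_iff res_add\<close>)
  then show ?thesis
    using assms by (auto simp: res_cong_iff uf_add_in_betaZ)
qed

lemma res_cong_zero_iff:
  "(u, principal_uf 0) \<in> res_cong w \<longleftrightarrow> u \<in> betaZ \<and> {n. 0 < n \<and> res u n = 0} \<in> w"
  by (simp add: res_cong_iff principal_in_betaZ res_principal)

lemma self_divisible_iff:
  "w \<in> betaN \<Longrightarrow> (w, principal_uf 0) \<in> res_cong w \<longleftrightarrow> self_divisible w"
  by (simp add: res_cong_zero_iff self_divisible_def betaN_iff betaZ_iff)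

text \<open>If \<open>n\<close> divides \<open>w\<close>, then \<open>w\<close>-almost every modulus
  is a multiple of \<open>n\<close>. Equality of residues modulo one such multiple passes down to
  \<open>n\<close>.\<close>

lemma res_cong_imp_res_eq:
  assumes w: "w \<in> betaN" and "(u, v) \<in> res_cong w" and n: "0 < n" "res w n = 0"
  shows "res u n = res v n"
proof -
  have uf: "ultrafilter w"
    using w by (simp add: betaN_iff)
  have uv: "u \<in> betaZ" "v \<in> betaZ" "{m. 0 < m \<and> res u m = res v m} \<in> w"
    using assms by (auto simp: res_cong_iff)
  have "{m. n dvd m} \<in> w"
    using n uf by (simp add: res_zero_iff[symmetric] betaZ_iff)
  with uv uf have "{m. n dvd m \<and> (0 < m \<and> res u m = res v m)} \<in> w"
    by (subst ultrafilter_Collect_conj) auto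
  then obtain m where "n dvd m" "0 < m" "res u m = res v m"
    using ultrafilter_nonempty[OF uf] by fastforce
  then show ?thesis
    using res_mod_dvd[of u m n] res_mod_dvd[of v m n] uv by simp
qed

text \<open>Self-divisibility gives the converse of \<open>res_cong_imp_res_eq\<close>, since the
  divisors of \<open>w\<close> then form a set in \<open>w\<close>.\<close>

lemma self_divisible_res_cong_iff:
  assumes "w \<in> betaN" "self_divisible w"
  shows "(u, v) \<in> res_cong w \<longleftrightarrow>
    u \<in> betaZ \<and> v \<in> betaZ \<and> (\<forall>n. 0 < n \<and> res w n = 0 \<longrightarrow> res u n = res v n)"
proof
  assume "(u, v) \<in> res_cong w"
  then show "u \<in> betaZ \<and> v \<in> betaZ \<and> (\<forall>n. 0 < n \<and> res w n = 0 \<longrightarrow> res u n = res v n)"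
    using res_cong_imp_res_eq[OF assms(1)] res_cong_iff by metis
next
  assume *: "u \<in> betaZ \<and> v \<in> betaZ \<and> (\<forall>n. 0 < n \<and> res w n = 0 \<longrightarrow> res u n = res v n)"
  have "ultrafilter w"
    using assms by (simp add: betaN_iff)
  moreover have "{n. 0 < n \<and> res w n = 0} \<subseteq> {n. 0 < n \<and> res u n = res v n}"
    using * by blast
  ultimately have "{n. 0 < n \<and> res u n = res v n} \<in> w"
    using assms(2) ultrafilter_mono unfolding self_divisible_def by blast
  then show "(u, v) \<in> res_cong w"
    using * by (simp add: res_cong_iff)
qed

section \<open>Divisors of ultrafilters\<close>

lemma res_one: "u \<in> betaZ \<Longrightarrow> res u 1 = 0"
  using res_bounds[of u 1] by simp

lemma res_lcm_zero:
  fixes a b :: int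
  assumes "u \<in> betaZ" "0 < a" "0 < b" "res u a = 0" "res u b = 0"
  shows "res u (lcm a b) = 0"
proof -
  have "{x. a dvd x \<and> b dvd x} \<in> u"
    using assms by (simp add: ultrafilter_Collect_conj res_zero_iff betaZ_iff)
  moreover have "0 < lcm a b"
    using assms by (simp add: lcm_pos_int)
  ultimately show ?thesis
    using assms by (simp add: res_zero_iff)
qed

text \<open>Take for \<open>L k\<close> the lcm of the elements of \<open>S\<close> up to
  \<open>k\<close>. The sequence is cofinal for divisibility, so a cluster point of it is divisible
  by all of \<open>S\<close>.\<close>

lemma lcm_cofinal_sequence:
  fixes S :: "int set"
  assumes "1 \<in> S" and pos: "\<And>n. n \<in> S \<Longrightarrow> 0 < n"
    and lcm: "\<And>m n. m \<in> S \<Longrightarrow> n \<in> S \<Longrightarrow> lcm m n \<in> S"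
  obtains L :: "nat \<Rightarrow> int" where "\<And>k. L k \<in> S" "\<And>n k. n \<in> S \<Longrightarrow> nat n \<le> k \<Longrightarrow> n dvd L k"
proof
  show "Lcm (S \<inter> {1..int k}) \<in> S" for k
  proof -
    have "Lcm F \<in> S" if "finite F" "F \<subseteq> S" for F
      using that by induction (auto simp: \<open>1 \<in> S\<close> lcm)
    then show ?thesis
      by simp
  qed
  show "n dvd Lcm (S \<inter> {1..int k})" if "n \<in> S" "nat n \<le> k" for n k
    using that pos[of n] by (intro dvd_Lcm) auto
qed

text \<open>The witness is a cluster point of lcms of divisors of \<open>w\<close>. A non-divisor of
  \<open>w\<close> divides no \<open>L k\<close>, because \<open>L k\<close> itself divides
  \<open>w\<close>.\<close>

lemma same_divisors_exists:
  assumes w: "w \<in> betaZ"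
  obtains z where "z \<in> betaZ" "\<And>n. 0 < n \<Longrightarrow> res z n = 0 \<longleftrightarrow> res w n = 0"
proof -
  define S where "S = {n. 0 < n \<and> res w n = 0}"
  have "1 \<in> S" "\<And>n. n \<in> S \<Longrightarrow> 0 < n" "\<And>m n. m \<in> S \<Longrightarrow> n \<in> S \<Longrightarrow> lcm m n \<in> S"
    using w by (auto simp: S_def res_one res_lcm_zero lcm_pos_int)
  then obtain L where L: "\<And>k. L k \<in> S" "\<And>n k. n \<in> S \<Longrightarrow> nat n \<le> k \<Longrightarrow> n dvd L k"
    using lcm_cofinal_sequence by blast
  obtain z where z: "z \<in> betaZ" "\<And>A. eventually (\<lambda>k. L k \<in> A) sequentially \<Longrightarrow> A \<in> z"
    using uf_of_sequence by blast
  have "res z n = 0 \<longleftrightarrow> res w n = 0" if n: "0 < n" for n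
  proof
    assume "res w n = 0"
    then have "{x. n dvd x} \<in> z"
      using n L by (intro z eventually_sequentiallyI[of "nat n"]) (auto simp: S_def)
    then show "res z n = 0"
      using n z by (simp add: res_zero_iff)
  next
    assume "res z n = 0"
    then have *: "{x. n dvd x} \<in> z"
      using n z by (simp add: res_zero_iff)
    show "res w n = 0"
    proof (rule ccontr)
      assume "res w n \<noteq> 0"
      then have "\<not> n dvd L k" for k
        using L(1)[of k] res_zero_dvd[OF w, of "L k" n] by (auto simp: S_def)
      then have "{x. \<not> n dvd x} \<in> z"
        by (intro z) auto
      then show False
        using * z by (simp add: ultrafilter_Collect_not betaZ_iff)
    qed
  qed
  with z that show ?thesis
    by blast
qed

text \<open>
  An ultrafilter with the same integer divisors as \<open>w\<close> is thus a limit of ultrafilters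
  congruent to zero modulo \<open>w\<close>.
\<close>

lemma same_divisors_approx:
  assumes w: "w \<in> betaN" and z: "z \<in> betaZ" "\<And>n. 0 < n \<Longrightarrow> res z n = 0 \<longleftrightarrow> res w n = 0"
    and N: "0 < N"
  obtains y where "(y, principal_uf 0) \<in> res_cong w" "res y N = res z N"
proof -
  have uf: "ultrafilter w" and wZ: "w \<in> betaZ" and pos: "{n. 0 < n} \<in> w"
    using w by (auto simp: betaN_iff betaZ_iff)
  \<comment> \<open>Only the finitely many non-divisors of \<open>w\<close> up to \<open>N\<close>
    are excluded as factors, so \<open>S\<close> lies in \<open>w\<close>. It suffices that every
    member of \<open>S\<close> divides \<open>y\<close>.\<close>
  define S where "S = {n. 0 < n \<and> (\<forall>d\<in>{1..N}. d dvd n \<longrightarrow> res w d = 0)}"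
  have one_S: "1 \<in> S"
    using res_one[OF wZ] by (auto simp: S_def)
  have pos_S: "0 < n" if "n \<in> S" for n
    using that by (simp add: S_def)
  \<comment> \<open>By distributivity, a divisor \<open>d\<close> of the lcm is itself the lcm of
    \<open>gcd d m\<close> and \<open>gcd d n\<close>, which are at most \<open>N\<close> and so
    divide \<open>w\<close>.\<close>
  have lcm_S: "lcm m n \<in> S" if "m \<in> S" "n \<in> S" for m n
  proof -
    have "res w d = 0" if d: "d \<in> {1..N}" "d dvd lcm m n" for d
    proof -
      have *: "gcd d k \<in> {1..N}" for k
      proof -
        have "0 < d" "d \<le> N"
          using d(1) by auto
        then have "gcd d k \<le> N" "0 < gcd d k"
          using gcd_le1_int[of d k] gcd_pos_int[of d k] by linarith+
        then show ?thesis
          unfolding atLeastAtMost_iff by linarith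
      qed
      have "res w (gcd d m) = 0" "res w (gcd d n) = 0"
        using *[of m] *[of n] \<open>m \<in> S\<close> \<open>n \<in> S\<close> by (simp_all add: S_def)
      then have "res w (lcm (gcd d m) (gcd d n)) = 0"
        using *[of m] *[of n] by (intro res_lcm_zero wZ) auto
      also have "lcm (gcd d m) (gcd d n) = gcd d (lcm m n)"
        by (simp add: gcd_lcm_distrib)
      also have "\<dots> = d"
        using d by simp
      finally show ?thesis .
    qed
    then show ?thesis
      using that by (auto simp: S_def lcm_pos_int)
  qed
  obtain L where L: "\<And>k. L k \<in> S" "\<And>n k. n \<in> S \<Longrightarrow> nat n \<le> k \<Longrightarrow> n dvd L k"
    using lcm_cofinal_sequence[OF one_S pos_S lcm_S] by blast
  \<comment> \<open>The congruence is solvable: \<open>gcd (L k) N\<close> is a divisor of a member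
    of \<open>S\<close> and at most \<open>N\<close>, so it divides \<open>w\<close>, hence
    \<open>z\<close>, hence \<open>res z N\<close>.\<close>
  have "\<exists>c. (c * L k) mod N = res z N" for k
  proof -
    define g where "g = gcd (L k) N"
    have g: "0 < g" "g \<le> N" "g dvd L k" "g dvd N"
      using N gcd_le2_int[of N "L k"] gcd_pos_int[of "L k" N] by (auto simp: g_def)
    then have "res w g = 0"
      using L(1)[of k] by (simp add: S_def)
    then have "res z N mod g = 0"
      using g z N res_mod_dvd[of z N g] by simp
    then obtain q where q: "res z N = g * q"
      by (auto simp: dvd_eq_mod_eq_0[symmetric])
    obtain a b where "a * L k + b * N = g"
      using bezout_int[of "L k" N] by (auto simp: g_def)
    then have "a * q * L k = res z N + N * (- b * q)"
      by (auto simp: q algebra_simps)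
    then have "(a * q * L k) mod N = res z N"
      using res_mod_self[OF z(1) N] by (metis mod_mult_self2)
    then show ?thesis
      by blast
  qed
  then obtain c where c: "\<And>k. (c k * L k) mod N = res z N"
    by metis
  obtain y where y: "y \<in> betaZ" "\<And>A. eventually (\<lambda>k. c k * L k \<in> A) sequentially \<Longrightarrow> A \<in> y"
    using uf_of_sequence[of "\<lambda>k. c k * L k"] by blast
  have "S \<subseteq> {n. 0 < n \<and> res y n = 0}"
  proof
    fix n
    assume n: "n \<in> S"
    then have "{x. n dvd x} \<in> y"
      using L by (intro y eventually_sequentiallyI[of "nat n"]) auto
    then show "n \<in> {n. 0 < n \<and> res y n = 0}"
      using n y by (auto simp: res_zero_iff S_def)
  qed
  moreover have "S \<in> w"
  proof -
    have "{n. d dvd n \<longrightarrow> res w d = 0} \<in> w" if "d \<in> {1..N}" for d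
    proof (cases "res w d = 0")
      case False
      then show ?thesis
        using that uf wZ by (simp add: ultrafilter_Collect_not res_zero_iff)
    qed (use uf in \<open>simp add: ultrafilter_UNIV\<close>)
    then show ?thesis
      using uf pos by (simp add: S_def ultrafilter_Collect_conj ultrafilter_Collect_ball)
  qed
  ultimately have "{n. 0 < n \<and> res y n = 0} \<in> w"
    using uf ultrafilter_mono by blast
  moreover have "res y N = res z N"
    by (rule res_eqI[OF y(1) y(2), of "{x. x mod N = res z N}"]) (simp_all add: c)
  ultimately show ?thesis
    using that y by (simp add: res_cong_zero_iff)
qed

section \<open>The weak congruence\<close>

context
  fixes emb :: "int \<Rightarrow> 's" and star :: "int list set \<Rightarrow> 's list set" and w :: "int set set"
  assumes elem: "elementary_extension emb star" and sat: "saturated star"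
    and w: "w \<in> betaN"
begin

text \<open>The tensor product of \<open>w\<close> with \<open>tensor u v\<close> serves as the
  ultrafilter \<open>U\<close> of \<open>uf_cong_iff\<close>.\<close>

lemma uf_scong_subset_uf_cong: "uf_scong star w \<subseteq> uf_cong star w"
proof
  fix p
  assume p: "p \<in> uf_scong star w"
  obtain u v where p_eq: "p = (u, v)"
    by (cases p)
  have uf: "ultrafilter w" and wZ: "w \<in> betaZ"
    using w by (auto simp: betaN_iff betaZ_iff)
  have uv: "u \<in> betaZ" "v \<in> betaZ" "{(n, x, y). n dvd x - y} \<in> tensor w (tensor u v)"
    using p uf_scong_iff_tensor[OF elem sat wZ, of u v] by (auto simp: p_eq)
  have t: "ultrafilter (tensor u v)"
    using uv by (simp add: betaZ_iff ultrafilter_tensor)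
  have "uf_image fst (tensor w (tensor u v)) = w" "uf_image snd (tensor w (tensor u v)) = tensor u v"
    using ultrafilter_UNIV[OF t] ultrafilter_empty[OF t] ultrafilter_UNIV[OF uf] ultrafilter_empty[OF uf]
    by (auto simp: uf_image_def tensor_def[of w])
  moreover have "ultrafilter (tensor w (tensor u v))"
    using uf t by (rule ultrafilter_tensor)
  ultimately show "p \<in> uf_cong star w"
    using uv unfolding p_eq uf_cong_iff[OF elem sat] by blast
qed

text \<open>If \<open>n\<close> divides \<open>w\<close>, then \<open>n\<close> divides the first
  entry of \<open>U\<close>-almost every triple, and hence the difference of the other two. So
  weakly congruent ultrafilters agree modulo all divisors of \<open>w\<close>.\<close>

lemma self_divisible_uf_cong_subset:
  assumes "self_divisible w"
  shows "uf_cong star w \<subseteq> uf_scong star w"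
proof
  fix p
  assume p: "p \<in> uf_cong star w"
  obtain u v where p_eq: "p = (u, v)"
    by (cases p)
  obtain U where uv: "u \<in> betaZ" "v \<in> betaZ" and U: "ultrafilter U" "uf_image fst U = w"
      "uf_image snd U = tensor u v" "{(n, x, y). n dvd x - y} \<in> U"
    using p unfolding p_eq uf_cong_iff[OF elem sat] by blast
  have "res u n = res v n" if n: "0 < n" "res w n = 0" for n
  proof -
    have "{x. n dvd x} \<in> w"
      using n w by (simp add: res_zero_iff[symmetric] betaN_iff betaZ_iff)
    then have "fst -` {x. n dvd x} \<inter> {(n, x, y). n dvd x - y} \<in> U"
      using U by (auto simp: uf_image_def ultrafilter_Int_iff)
    moreover have "fst -` {x. n dvd x} \<inter> {(n, x, y). n dvd x - y} \<subseteq> snd -` {(x, y). n dvd x - y}"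
      using dvd_trans by auto
    ultimately have "{(x, y). n dvd x - y} \<in> tensor u v"
      unfolding U(3)[symmetric] uf_image_def mem_Collect_eq by (rule ultrafilter_mono[OF U(1)])
    then show ?thesis
      using uv n by (simp add: tensor_dvd_diff_iff)
  qed
  then show "p \<in> uf_scong star w"
    using uv by (simp add: p_eq uf_scong_eq_res_cong[OF elem sat w]
        self_divisible_res_cong_iff[OF w assms])
qed

text \<open>The two prescribed images and the divisibility relation are jointly consistent: choose a
  positive \<open>n\<close> in \<open>A\<close>; as the residues modulo \<open>n\<close> agree,
  \<open>B\<close> contains a pair \<open>(x, y)\<close> with \<open>n\<close> dividing
  \<open>x - y\<close>.\<close>

lemma uf_cong_if_same_residues:
  assumes uv: "u \<in> betaZ" "v \<in> betaZ" and res: "\<And>n. 0 < n \<Longrightarrow> res u n = res v n"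
  shows "(u, v) \<in> uf_cong star w"
proof -
  let ?E = "{(n, x, y). n dvd x - y} :: (int \<times> int \<times> int) set"
  let ?B = "\<lambda>A B. fst -` A \<inter> snd -` B \<inter> ?E"
  have uf: "ultrafilter w" and pos: "{n. 0 < n} \<in> w"
    using w by (auto simp: betaN_iff)
  have t: "ultrafilter (tensor u v)"
    using uv by (simp add: betaZ_iff ultrafilter_tensor)
  define C where "C = {?B A B | A B. A \<in> w \<and> B \<in> tensor u v}"
  have nonempty: "?B A B \<noteq> {}" if "A \<in> w" "B \<in> tensor u v" for A B
  proof -
    have "A \<inter> {n. 0 < n} \<in> w"
      using uf pos that by (simp add: ultrafilter_Int_iff)
    then obtain n where n: "n \<in> A" "0 < n"
      using ultrafilter_nonempty[OF uf] by blast
    then have "B \<inter> {(x, y). n dvd x - y} \<in> tensor u v"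
      using t uv res that by (simp add: ultrafilter_Int_iff tensor_dvd_diff_iff)
    then obtain x y where "(x, y) \<in> B" "n dvd x - y"
      using ultrafilter_nonempty[OF t] by blast
    then have "(n, x, y) \<in> ?B A B"
      using n by simp
    then show ?thesis
      by blast
  qed
  \<comment> \<open>Finite intersections of members of \<open>C\<close> contain a set of the same
    shape, so nonemptiness of single members suffices.\<close>
  have directed: "\<exists>A\<in>w. \<exists>B\<in>tensor u v. ?B A B \<subseteq> \<Inter>F" if "finite F" "F \<subseteq> C" for F
    using that
  proof induction
    case empty
    then show ?case
      using ultrafilter_UNIV[OF uf] ultrafilter_UNIV[OF t] by auto
  next
    case (insert X F)
    then obtain A B where AB: "A \<in> w" "B \<in> tensor u v" "?B A B \<subseteq> \<Inter>F"
      by auto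
    obtain A' B' where AB': "A' \<in> w" "B' \<in> tensor u v" "X = ?B A' B'"
      using insert.prems by (auto simp: C_def)
    have "?B (A \<inter> A') (B \<inter> B') \<subseteq> \<Inter>(insert X F)"
      using AB(3) unfolding AB'(3) by auto
    moreover have "A \<inter> A' \<in> w" "B \<inter> B' \<in> tensor u v"
      using AB AB' uf t by (simp_all add: ultrafilter_Int_iff)
    ultimately show ?case
      by blast
  qed
  have "\<Inter>F \<noteq> {}" if "finite F" "F \<subseteq> C" for F
    using directed[OF that] nonempty by (metis subset_empty)
  then obtain U where U: "ultrafilter U" "C \<subseteq> U"
    using ultrafilter_exists by blast
  have B_mem: "?B A B \<in> U" if "A \<in> w" "B \<in> tensor u v" for A B
    using U(2) that by (auto simp: C_def)
  have "w \<subseteq> uf_image fst U"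
  proof
    fix A
    assume "A \<in> w"
    then have "?B A UNIV \<in> U"
      using B_mem ultrafilter_UNIV[OF t] by blast
    then show "A \<in> uf_image fst U"
      using ultrafilter_mono[OF U(1)] by (auto simp: uf_image_def)
  qed
  then have "uf_image fst U = w"
    by (rule ultrafilter_eqI[OF uf ultrafilter_image[OF U(1)], symmetric])
  moreover have "tensor u v \<subseteq> uf_image snd U"
  proof
    fix B
    assume "B \<in> tensor u v"
    then have "?B UNIV B \<in> U"
      using B_mem ultrafilter_UNIV[OF uf] by blast
    then show "B \<in> uf_image snd U"
      using ultrafilter_mono[OF U(1)] by (auto simp: uf_image_def)
  qed
  then have "uf_image snd U = tensor u v"
    by (rule ultrafilter_eqI[OF t ultrafilter_image[OF U(1)], symmetric])
  moreover have "?E \<in> U"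
    using B_mem[OF ultrafilter_UNIV[OF uf] ultrafilter_UNIV[OF t]] by simp
  ultimately show ?thesis
    using uv U(1) unfolding uf_cong_iff[OF elem sat] by blast
qed

text \<open>The same element realises \<open>w\<close> both as modulus and as argument, which the
  strong congruence does not permit in general.\<close>

lemma uf_cong_self_zero: "(w, principal_uf 0) \<in> uf_cong star w"
proof -
  let ?U = "uf_image (\<lambda>n. (n, n, 0)) w :: (int \<times> int \<times> int) set set"
  have uf: "ultrafilter w" and wZ: "w \<in> betaZ"
    using w by (auto simp: betaN_iff betaZ_iff)
  have "ultrafilter ?U"
    using uf by (rule ultrafilter_image)
  moreover have "uf_image fst ?U = w"
    by (simp add: uf_image_def vimage_def)
  moreover have "uf_image snd ?U = tensor w (principal_uf 0)"
    by (simp add: uf_image_def tensor_def principal_uf_def vimage_def)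
  moreover have "{(n, x, y). n dvd x - y} \<in> ?U"
    using ultrafilter_UNIV[OF uf] by (simp add: uf_image_def vimage_def)
  ultimately show ?thesis
    using wZ principal_in_betaZ unfolding uf_cong_iff[OF elem sat] by blast
qed

text \<open>Almost every triple has the form \<open>(n, x, 0)\<close> with \<open>n\<close> in
  \<open>A\<close> and \<open>n\<close> dividing \<open>x\<close>. Upward closed sets thus obstruct
  weak congruence to zero.\<close>

lemma uf_cong_zero_imp_mem:
  assumes "(v, principal_uf 0) \<in> uf_cong star w" "A \<in> w" "\<And>m n. m \<in> A \<Longrightarrow> m dvd n \<Longrightarrow> n \<in> A"
  shows "A \<in> v"
proof -
  obtain U where U: "ultrafilter U" "uf_image fst U = w"
      "uf_image snd U = tensor v (principal_uf 0)" "{(n, x, y). n dvd x - y} \<in> U"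
    using assms(1) unfolding uf_cong_iff[OF elem sat] by blast
  have v: "v \<in> betaZ"
    using assms(1) by (simp add: uf_cong_def)
  have "{(x, y). y = 0} \<in> uf_image snd U"
    using v by (simp add: U(3) tensor_def principal_uf_def betaZ_iff ultrafilter_UNIV)
  then have "fst -` A \<inter> {(n, x, y). n dvd x - y} \<inter> snd -` {(x, y). y = 0} \<in> U"
    using U assms(2) by (auto simp: uf_image_def ultrafilter_Int_iff)
  moreover have "fst -` A \<inter> {(n, x, y). n dvd x - y} \<inter> snd -` {(x, y). y = 0} \<subseteq>
      snd -` {(x, y). x \<in> A}"
    using assms(3) by auto
  ultimately have "{(x, y). x \<in> A} \<in> tensor v (principal_uf (0 :: int))"
    unfolding U(3)[symmetric] uf_image_def mem_Collect_eq by (rule ultrafilter_mono[OF U(1)])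
  then show ?thesis
    by (simp add: tensor_def principal_uf_def)
qed

end

text \<open>
  The elements of the sequence \<open>x\<close> below tend to \<open>w\<close> profinitely, and any two of them have a
  greatest common divisor dividing \<open>w\<close>. So a non-self-divisible \<open>w\<close> cannot contain both the
  divisors of the even-indexed and the divisors of the odd-indexed elements.
\<close>

lemma not_self_divisible_witness:
  assumes w: "w \<in> betaN" and nsd: "\<not> self_divisible w"
  obtains v A where "v \<in> betaZ" "\<And>n. 0 < n \<Longrightarrow> res v n = res w n"
    "A \<in> w" "A \<notin> v" "\<And>m n. m \<in> A \<Longrightarrow> m dvd n \<Longrightarrow> n \<in> A"
proof -
  have uf: "ultrafilter w" and wZ: "w \<in> betaZ" and pos: "{n. 0 < n} \<in> w"
    using w by (auto simp: betaN_iff betaZ_iff)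
  \<comment> \<open>\<open>N\<close> and \<open>x\<close> are defined by a joint recursion with
    \<open>x\<close> inlined. The factor \<open>x k\<close> makes all later terms congruent to
    \<open>w\<close> modulo \<open>x k\<close>; the factor \<open>k + 1\<close> makes every positive
    integer eventually divide \<open>N\<close>.\<close>
  define N where "N = rec_nat (1 :: int) (\<lambda>k N. N * (res w N + N) * (int k + 1))"
  \<comment> \<open>Adding \<open>N k\<close> keeps the residue modulo \<open>N k\<close> and makes
    \<open>x k\<close> positive even if that residue is zero.\<close>
  define x where "x k = res w (N k) + N k" for k
  have N_Suc: "N (Suc k) = N k * x k * (int k + 1)" for k
    by (simp add: N_def x_def)
  have N_pos: "0 < N k" for k
  proof (induction k)
    case 0
    then show ?case
      by (simp add: N_def)
  next
    case (Suc k)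
    then have "0 < x k"
      using res_bounds[OF wZ Suc] by (simp add: x_def)
    with Suc show ?case
      by (simp add: N_Suc)
  qed
  have x_pos: "0 < x k" for k
    using res_bounds[OF wZ N_pos[of k]] N_pos[of k] by (simp add: x_def)
  have N_dvd: "N i dvd N k" if "i \<le> k" for i k
    using that by (induction rule: dec_induct) (auto simp: N_Suc)
  have dvd_N: "x i dvd N k" "int i + 1 dvd N k" if "i < k" for i k
  proof -
    have "N (Suc i) dvd N k"
      using that by (intro N_dvd) simp
    then show "x i dvd N k" "int i + 1 dvd N k"
      unfolding N_Suc by (auto dest: dvd_mult_left dvd_mult_right)
  qed
  have x_mod: "x k mod n = res w n" if "n dvd N k" for k n
  proof -
    have "x k mod n = res w (N k) mod n"
      unfolding x_def using that by (metis dvd_def mod_mult_self2)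
    then show ?thesis
      using res_mod_dvd[OF wZ N_pos that] by simp
  qed
  \<comment> \<open>A divisor \<open>d\<close> of the earlier term \<open>x i\<close> divides
    \<open>N k\<close>, so \<open>x k\<close> has the residue of \<open>w\<close> modulo
    \<open>d\<close>, which is zero.\<close>
  have common: "res w d = 0" if "d dvd x i" "d dvd x k" "i < k" "0 < d" for d i k
    using x_mod[of d k] that dvd_N(1)[of i k] by (metis dvd_imp_mod_0 dvd_trans)
  define Dv where "Dv j = {d. \<exists>k. d dvd x (2 * k + j)}" for j
  have "Dv 0 \<inter> Dv 1 \<inter> {n. 0 < n} \<subseteq> {n. 0 < n \<and> res w n = 0}"
  proof
    fix d
    assume "d \<in> Dv 0 \<inter> Dv 1 \<inter> {n. 0 < n}"
    then obtain i k where "d dvd x (2 * i)" "d dvd x (2 * k + 1)" "0 < d"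
      by (auto simp: Dv_def)
    moreover have "2 * i < 2 * k + 1 \<or> 2 * k + 1 < 2 * i"
      by presburger
    ultimately have "res w d = 0"
      using common by metis
    with \<open>0 < d\<close> show "d \<in> {n. 0 < n \<and> res w n = 0}"
      by simp
  qed
  then have "Dv 0 \<inter> Dv 1 \<inter> {n. 0 < n} \<notin> w"
    using nsd ultrafilter_mono[OF uf] unfolding self_divisible_def by blast
  then obtain j where j: "Dv j \<notin> w"
    using pos by (auto simp: ultrafilter_Int_iff[OF uf])
  obtain v where v: "v \<in> betaZ" "\<And>A. eventually (\<lambda>k. x (2 * k + j) \<in> A) sequentially \<Longrightarrow> A \<in> v"
    using uf_of_sequence[of "\<lambda>k. x (2 * k + j)"] by blast
  show ?thesis
  proof
    show "res v n = res w n" if n: "0 < n" for n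
    proof (rule res_eqI[OF v(1) v(2), of "{x. x mod n = res w n}"])
      have "n dvd N (2 * k + j)" if "nat n \<le> k" for k
        \<comment> \<open>The recursion multiplies by \<open>i + 1\<close> at stage
          \<open>i\<close>, so \<open>n\<close> enters at stage \<open>n - 1\<close>.\<close>
        using dvd_N(2)[of "nat n - 1" "2 * k + j"] that n by simp
      then show "eventually (\<lambda>k. x (2 * k + j) \<in> {x. x mod n = res w n}) sequentially"
        by (intro eventually_sequentiallyI[of "nat n"]) (simp add: x_mod)
    qed simp
    \<comment> \<open>\<open>Dv j\<close> is closed under divisors and contains the whole
      subsequence defining \<open>v\<close>; so its complement is upward closed and not in
      \<open>v\<close>.\<close>
    show "- Dv j \<in> w"
      using j by (simp add: ultrafilter_Compl_iff[OF uf])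
    have "x (2 * k + j) \<in> Dv j" for k
      unfolding Dv_def using dvd_refl by blast
    then have "Dv j \<in> v"
      by (intro v(2) always_eventually allI)
    then show "- Dv j \<notin> v"
      using v(1) by (simp add: ultrafilter_Compl_iff betaZ_iff)
    show "n \<in> - Dv j" if "m \<in> - Dv j" "m dvd n" for m n
      using that dvd_trans by (auto simp: Dv_def)
  qed (rule v(1))
qed

text \<open>Otherwise \<open>v\<close> is weakly congruent to \<open>w\<close> by equality of
  residues, and \<open>w\<close> to zero, whereas the upward closed set \<open>A\<close> keeps
  \<open>v\<close> from being weakly congruent to zero.\<close>

lemma uf_cong_trans_imp_self_divisible:
  assumes "elementary_extension emb star" "saturated star" "w \<in> betaN" "trans (uf_cong star w)"
  shows "self_divisible w"
proof (rule ccontr)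
  assume "\<not> self_divisible w"
  then obtain v A where v: "v \<in> betaZ" "\<And>n. 0 < n \<Longrightarrow> res v n = res w n"
    and A: "A \<in> w" "A \<notin> v" "\<And>m n. m \<in> A \<Longrightarrow> m dvd n \<Longrightarrow> n \<in> A"
    using not_self_divisible_witness[OF assms(3)] by metis
  have "w \<in> betaZ"
    using assms(3) by (simp add: betaN_iff betaZ_iff)
  then have "(v, w) \<in> uf_cong star w"
    using v by (intro uf_cong_if_same_residues[OF assms(1-3)])
  then have "(v, principal_uf 0) \<in> uf_cong star w"
    using uf_cong_self_zero[OF assms(1-3)] assms(4) by (meson transD)
  then show False
    using uf_cong_zero_imp_mem[OF assms(1-3)] A by blast
qed

section \<open>The quotient group\<close>

abbreviation uf_quotient :: "int set set \<Rightarrow> int set set set monoid" where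
  "uf_quotient w \<equiv> quotient_monoid betaZ_monoid (res_cong w)"

abbreviation uf_class :: "int set set \<Rightarrow> int set set \<Rightarrow> int set set set" where
  "uf_class w u \<equiv> res_cong w `` {u}"

lemma carrier_uf_quotient: "carrier (uf_quotient w) = betaZ // res_cong w"
  by (simp add: quotient_monoid_def betaZ_monoid_def)

lemma one_uf_quotient: "\<one>\<^bsub>uf_quotient w\<^esub> = uf_class w (principal_uf 0)"
  by (simp add: quotient_monoid_def betaZ_monoid_def)

lemma uf_class_in_carrier: "u \<in> betaZ \<Longrightarrow> uf_class w u \<in> carrier (uf_quotient w)"
  by (simp add: carrier_uf_quotient quotientI)

lemma uf_class_eq_iff:
  "w \<in> betaN \<Longrightarrow> u \<in> betaZ \<Longrightarrow> v \<in> betaZ \<Longrightarrow> uf_class w u = uf_class w v \<longleftrightarrow> (u, v) \<in> res_cong w"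
  using eq_equiv_class_iff[OF equiv_res_cong] by metis

lemma carrier_uf_quotientE:
  assumes "X \<in> carrier (uf_quotient w)"
  obtains u where "u \<in> betaZ" "X = uf_class w u"
  using assms unfolding carrier_uf_quotient by (rule quotientE)

lemma mult_uf_quotient:
  assumes w: "w \<in> betaN" and uv: "u \<in> betaZ" "v \<in> betaZ"
  shows "uf_class w u \<otimes>\<^bsub>uf_quotient w\<^esub> uf_class w v = uf_class w (uf_add u v)"
proof -
  have "uf_class w (uf_add u' v') = uf_class w (uf_add u v)"
    if "u' \<in> uf_class w u" "v' \<in> uf_class w v" for u' v'
    using res_cong_add[OF w, of u u' v v'] that equiv_class_eq[OF equiv_res_cong[OF w]] by auto
  moreover have "u \<in> uf_class w u" "v \<in> uf_class w v"
    using equiv_class_self[OF equiv_res_cong[OF w]] uv by auto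
  ultimately have "(\<Union>x\<in>uf_class w u. \<Union>y\<in>uf_class w v. uf_class w (uf_add x y)) =
      uf_class w (uf_add u v)"
    by blast
  then show ?thesis
    by (simp add: quotient_monoid_def betaZ_monoid_def)
qed

lemma uf_class_eqI:
  assumes "w \<in> betaN" "u \<in> betaZ" "v \<in> betaZ" "\<And>n. 0 < n \<Longrightarrow> res u n = res v n"
  shows "uf_class w u = uf_class w v"
  using assms by (simp add: uf_class_eq_iff res_congI)

text \<open>The laws are checked on residues. In particular \<open>uf_neg u\<close> represents an
  inverse, although it is in general no inverse of \<open>u\<close> in \<open>betaZ\<close>.\<close>

lemma group_uf_quotient:
  assumes w: "w \<in> betaN"
  shows "group (uf_quotient w)"
proof (rule groupI)
  note [simp] = mult_uf_quotient[OF w] one_uf_quotient uf_class_in_carrier uf_add_in_betaZ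
    principal_in_betaZ uf_neg_in_betaZ
  show "\<one>\<^bsub>uf_quotient w\<^esub> \<in> carrier (uf_quotient w)"
    by simp
  fix X
  assume "X \<in> carrier (uf_quotient w)"
  then obtain u where u: "u \<in> betaZ" "X = uf_class w u"
    by (rule carrier_uf_quotientE)
  have "uf_class w (uf_add (principal_uf 0) u) = uf_class w u"
    using u by (intro uf_class_eqI w) (auto simp: res_add res_principal res_mod_self)
  then show "\<one>\<^bsub>uf_quotient w\<^esub> \<otimes>\<^bsub>uf_quotient w\<^esub> X = X"
    using u by simp
  have "uf_class w (uf_add (uf_neg u) u) = uf_class w (principal_uf 0)"
    using u by (intro uf_class_eqI w) (auto simp: res_add res_neg res_principal mod_simps)
  then show "\<exists>Y\<in>carrier (uf_quotient w). Y \<otimes>\<^bsub>uf_quotient w\<^esub> X = \<one>\<^bsub>uf_quotient w\<^esub>"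
    using u by (intro bexI[of _ "uf_class w (uf_neg u)"]) simp_all
  fix Y
  assume "Y \<in> carrier (uf_quotient w)"
  then obtain v where v: "v \<in> betaZ" "Y = uf_class w v"
    by (rule carrier_uf_quotientE)
  then show "X \<otimes>\<^bsub>uf_quotient w\<^esub> Y \<in> carrier (uf_quotient w)"
    using u by simp
  fix Z
  assume "Z \<in> carrier (uf_quotient w)"
  then obtain t where t: "t \<in> betaZ" "Z = uf_class w t"
    by (rule carrier_uf_quotientE)
  have "uf_class w (uf_add (uf_add u v) t) = uf_class w (uf_add u (uf_add v t))"
    using u v t by (intro uf_class_eqI w) (auto simp: res_add mod_simps add.assoc)
  then show "X \<otimes>\<^bsub>uf_quotient w\<^esub> Y \<otimes>\<^bsub>uf_quotient w\<^esub> Z = X \<otimes>\<^bsub>uf_quotient w\<^esub> (Y \<otimes>\<^bsub>uf_quotient w\<^esub> Z)"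
    using u v t by simp
qed

lemma inv_uf_quotient:
  assumes w: "w \<in> betaN" and u: "u \<in> betaZ"
  shows "inv\<^bsub>uf_quotient w\<^esub> uf_class w u = uf_class w (uf_neg u)"
proof -
  have "uf_class w (uf_add (uf_neg u) u) = uf_class w (principal_uf 0)"
    using u by (intro uf_class_eqI w)
      (auto simp: res_add res_neg res_principal mod_simps uf_add_in_betaZ uf_neg_in_betaZ
        principal_in_betaZ)
  then have "uf_class w (uf_neg u) \<otimes>\<^bsub>uf_quotient w\<^esub> uf_class w u = \<one>\<^bsub>uf_quotient w\<^esub>"
    using u by (simp add: mult_uf_quotient[OF w] uf_neg_in_betaZ one_uf_quotient)
  then show ?thesis
    using u by (intro group.inv_equality[OF group_uf_quotient[OF w]])
      (auto simp: uf_class_in_carrier uf_neg_in_betaZ)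
qed

text \<open>An iterated sum, not the image under multiplication by \<open>n\<close>: this is what
  additive maps on the quotient can evaluate.\<close>

primrec uf_mult :: "nat \<Rightarrow> int set set \<Rightarrow> int set set" where
  "uf_mult 0 v = principal_uf 0"
| "uf_mult (Suc n) v = uf_add v (uf_mult n v)"

lemma uf_mult_in_betaZ: "v \<in> betaZ \<Longrightarrow> uf_mult N v \<in> betaZ"
  by (induction N) (auto simp: principal_in_betaZ uf_add_in_betaZ)

lemma res_uf_mult:
  assumes "v \<in> betaZ" "0 < n"
  shows "res (uf_mult N v) n = (int N * res v n) mod n"
proof (induction N)
  case 0
  then show ?case
    by (simp add: res_principal)
next
  case (Suc N)
  then show ?case
    using assms by (simp add: res_add uf_mult_in_betaZ mod_simps algebra_simps)
qed

text \<open>Almost all integers are multiples of \<open>N\<close> in the sense of \<open>t\<close>,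
  so the image under division by \<open>N\<close> is a quotient as far as residues are
  concerned.\<close>

lemma uf_divide:
  assumes t: "t \<in> betaZ" and N: "0 < N" "res t (int N) = 0"
  obtains v where "v \<in> betaZ" "\<And>n. 0 < n \<Longrightarrow> res (uf_mult N v) n = res t n"
proof
  let ?v = "uf_image (\<lambda>x. x div int N) t"
  show v: "?v \<in> betaZ"
    using t by (rule uf_image_in_betaZ)
  show "res (uf_mult N ?v) n = res t n" if n: "0 < n" for n
  proof (rule res_eqI[OF t, symmetric])
    have "{x. int N dvd x} \<in> t"
      using t N by (simp add: res_zero_iff)
    moreover have "{x. (x div int N) mod n = res ?v n} \<in> t"
      using res_mem[OF v n] by (simp add: uf_image_def vimage_def)
    ultimately show "{x. int N dvd x \<and> (x div int N) mod n = res ?v n} \<in> t"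
      using t by (simp add: ultrafilter_Collect_conj betaZ_iff)
  next
    fix x
    assume "x \<in> {x. int N dvd x \<and> (x div int N) mod n = res ?v n}"
    then have "int N * (x div int N) = x" "(x div int N) mod n = res ?v n"
      by auto
    then have "x mod n = (int N * res ?v n) mod n"
      by (metis mod_mult_right_eq)
    then show "x mod n = res (uf_mult N ?v) n"
      using v n by (simp add: res_uf_mult)
  qed
qed

text \<open>
  The class of \<open>z\<close> is infinitely divisible in the quotient. It is trivial only if \<open>w\<close> is
  self-divisible.
\<close>

lemma infinitely_divisible_element:
  assumes w: "w \<in> betaN"
  obtains z where "z \<in> betaZ" "(z, principal_uf 0) \<in> res_cong w \<longleftrightarrow> self_divisible w"
    "\<And>N. 0 < N \<Longrightarrow> \<exists>v\<in>betaZ. (z, uf_mult N v) \<in> res_cong w"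
proof -
  have uf: "ultrafilter w" and wZ: "w \<in> betaZ"
    using w by (auto simp: betaN_iff betaZ_iff)
  obtain z where z: "z \<in> betaZ" "\<And>n. 0 < n \<Longrightarrow> res z n = 0 \<longleftrightarrow> res w n = 0"
    using same_divisors_exists[OF wZ] by metis
  show ?thesis
  proof
    have "{n. 0 < n \<and> res z n = 0} = {n. 0 < n \<and> res w n = 0}"
      using z(2) by auto
    then show "(z, principal_uf 0) \<in> res_cong w \<longleftrightarrow> self_divisible w"
      using z(1) by (simp add: res_cong_zero_iff self_divisible_def)
    fix N :: nat
    assume N: "0 < N"
    then obtain y where y: "(y, principal_uf 0) \<in> res_cong w" "res y (int N) = res z (int N)"
      using same_divisors_approx[OF w z, of "int N"] by auto
    then have yZ: "y \<in> betaZ"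
      by (simp add: res_cong_iff)
    \<comment> \<open>The difference \<open>z - y\<close> has residue zero modulo \<open>N\<close>,
      so it can be divided by \<open>N\<close>; as \<open>y\<close> is congruent to zero, it is
      congruent to \<open>z\<close>.\<close>
    define t where "t = uf_add z (uf_neg y)"
    have t: "t \<in> betaZ"
      using z yZ by (simp add: t_def uf_add_in_betaZ uf_neg_in_betaZ)
    have res_t: "res t n = (res z n - res y n) mod n" if "0 < n" for n
      using that z yZ by (simp add: t_def res_add uf_neg_in_betaZ res_neg mod_simps)
    obtain v where v: "v \<in> betaZ" "\<And>n. 0 < n \<Longrightarrow> res (uf_mult N v) n = res t n"
      using uf_divide[OF t N] res_t[of "int N"] N y(2) by auto
    have "{n. 0 < n \<and> res y n = 0} \<subseteq> {n. 0 < n \<and> res z n = res (uf_mult N v) n}"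
      using v(2) res_t z(1) by (auto simp: res_mod_self)
    then have "{n. 0 < n \<and> res z n = res (uf_mult N v) n} \<in> w"
      using y(1) ultrafilter_mono[OF uf] unfolding res_cong_zero_iff by blast
    then show "\<exists>v\<in>betaZ. (z, uf_mult N v) \<in> res_cong w"
      using v z by (auto simp: res_cong_iff uf_mult_in_betaZ)
  qed (rule z(1))
qed

text \<open>\<open>\<theta>\<close> is a homomorphism from the quotient to the integers modulo
  \<open>M\<close>. Writing \<open>z\<close> as an \<open>M\<close>-fold sum kills its
  value.\<close>

lemma additive_eq_zero_if_divisible:
  assumes w: "w \<in> betaN" and z: "\<And>N. 0 < N \<Longrightarrow> \<exists>v\<in>betaZ. (z, uf_mult N v) \<in> res_cong w"
    and cong: "\<And>u v. (u, v) \<in> res_cong w \<Longrightarrow> \<theta> u = \<theta> v"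
    and add: "\<And>u v. u \<in> betaZ \<Longrightarrow> v \<in> betaZ \<Longrightarrow> \<theta> (uf_add u v) = (\<theta> u + \<theta> v) mod int M"
    and bounds: "\<And>u. u \<in> betaZ \<Longrightarrow> 0 \<le> \<theta> u \<and> \<theta> u < int M"
  shows "\<theta> (principal_uf 0) = 0" "\<theta> z = 0"
proof -
  have "(uf_add (principal_uf 0) (principal_uf 0), principal_uf 0) \<in> res_cong w"
    by (intro res_congI w) (auto simp: res_add res_principal uf_add_in_betaZ principal_in_betaZ)
  then have "\<theta> (principal_uf 0) = (\<theta> (principal_uf 0) + \<theta> (principal_uf 0)) mod int M"
    using cong add principal_in_betaZ by metis
  then have "int M dvd \<theta> (principal_uf 0)"
    by (metis add_diff_cancel_left' dvd_minus_mod minus_dvd_iff add_diff_cancel_right' mod_mod_trivial mod_eq_dvd_iff)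
  then show zero: "\<theta> (principal_uf 0) = 0"
    using bounds[OF principal_in_betaZ] by (metis zdvd_not_zless le_less)
  have mult: "\<theta> (uf_mult N v) = (int N * \<theta> v) mod int M" if "v \<in> betaZ" for N v
  proof (induction N)
    case (Suc N)
    then show ?case
      using that by (simp add: add uf_mult_in_betaZ mod_simps algebra_simps)
  qed (simp add: zero)
  have "0 < M"
    using bounds[OF principal_in_betaZ[of 0]] by simp
  then obtain v where "v \<in> betaZ" "(z, uf_mult M v) \<in> res_cong w"
    using z by blast
  then show "\<theta> z = 0"
    using cong mult by simp
qed

section \<open>The product of the local factors\<close>

lemma prime_exponents_iff:
  assumes "w \<in> betaZ" "0 < p"
  shows "k \<in> prime_exponents w p \<longleftrightarrow> res w (int (p ^ k)) = 0"
  using assms by (simp add: prime_exponents_def res_zero_iff)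

lemma prime_exponents_mono:
  assumes "w \<in> betaZ" "0 < p" "k \<in> prime_exponents w p" "j \<le> k"
  shows "j \<in> prime_exponents w p"
proof -
  have "int (p ^ j) dvd int (p ^ k)"
    using assms(4) by (simp add: le_imp_power_dvd)
  then show ?thesis
    using assms res_zero_dvd[of w "int (p ^ k)" "int (p ^ j)"] by (simp add: prime_exponents_iff)
qed

lemma prime_exponents_zero: "w \<in> betaZ \<Longrightarrow> 0 \<in> prime_exponents w p"
proof -
  assume "w \<in> betaZ"
  moreover have "{x. int (p ^ 0) dvd x} = UNIV"
    by simp
  ultimately show ?thesis
    by (simp only: prime_exponents_def mem_Collect_eq betaZ_iff ultrafilter_UNIV)
qed

text \<open>Reduction modulo \<open>p ^ k\<close>, uniformly for both kinds of factor. On a finite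
  factor it need not be additive for \<open>k\<close> beyond the maximal exponent, whence the
  restriction in \<open>coord_mult\<close>.\<close>

fun coord :: "nat \<Rightarrow> nat \<Rightarrow> int + (nat \<Rightarrow> int) \<Rightarrow> int" where
  "coord p k (Inl a) = a mod int (p ^ k)"
| "coord p k (Inr f) = f k"

text \<open>The \<open>p\<close>-component of the isomorphism, on representatives.\<close>

definition local_residue :: "int set set \<Rightarrow> nat \<Rightarrow> int set set \<Rightarrow> int + (nat \<Rightarrow> int)" where
  "local_residue w p u =
     (if finite (prime_exponents w p) then Inl (res u (int (p ^ Max (prime_exponents w p))))
      else Inr (\<lambda>k. res u (int (p ^ k))))"

context
  fixes w :: "int set set" and p :: nat
  assumes w: "w \<in> betaZ" and p: "0 < p"
begin

lemma Max_prime_exponents: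
  assumes "finite (prime_exponents w p)"
  shows "Max (prime_exponents w p) \<in> prime_exponents w p"
    "k \<in> prime_exponents w p \<Longrightarrow> int (p ^ k) dvd int (p ^ Max (prime_exponents w p))"
  using assms prime_exponents_zero[OF w] by (auto intro!: Max_in le_imp_power_dvd)

lemma carrier_G_factor:
  "carrier (G_factor w p) =
     (if finite (prime_exponents w p) then Inl ` {0..<int (p ^ Max (prime_exponents w p))}
      else Inr ` {f. \<forall>k. 0 \<le> f k \<and> f k < int (p ^ k) \<and> f (Suc k) mod int (p ^ k) = f k})"
  using p by (simp add: G_factor_def image_group_def carrier_integer_mod_group padic_group_def)

lemma coord_mult:
  assumes "x \<in> carrier (G_factor w p)" "y \<in> carrier (G_factor w p)" "k \<in> prime_exponents w p"
  shows "coord p k (x \<otimes>\<^bsub>G_factor w p\<^esub> y) = (coord p k x + coord p k y) mod int (p ^ k)"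
proof (cases "finite (prime_exponents w p)")
  case True
  let ?m = "p ^ Max (prime_exponents w p)"
  obtain a b where ab: "x = Inl a" "y = Inl b" "a \<in> {0..<int ?m}" "b \<in> {0..<int ?m}"
    using assms True by (auto simp: carrier_G_factor)
  then have "x \<otimes>\<^bsub>G_factor w p\<^esub> y = Inl ((a + b) mod int ?m)"
    using True p by (simp add: G_factor_def image_group_def carrier_integer_mod_group inv_into_f_f)
  then show ?thesis
    using Max_prime_exponents(2)[OF True assms(3)] ab by (simp add: mod_mod_cancel mod_simps)
next
  case False
  obtain f g where fg: "x = Inr f" "y = Inr g" "f \<in> carrier (padic_group p)" "g \<in> carrier (padic_group p)"
    using assms False by (auto simp: G_factor_def image_group_def)
  then have "x \<otimes>\<^bsub>G_factor w p\<^esub> y = Inr (f \<otimes>\<^bsub>padic_group p\<^esub> g)"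
    using False by (simp add: G_factor_def image_group_def inv_into_f_f)
  then show ?thesis
    by (simp add: fg padic_group_def)
qed

lemma coord_bounds:
  assumes "x \<in> carrier (G_factor w p)"
  shows "0 \<le> coord p k x \<and> coord p k x < int (p ^ k)"
  using assms p by (auto simp: carrier_G_factor split: if_splits)

lemma coord_mod:
  assumes x: "x \<in> carrier (G_factor w p)" and "j \<le> k"
  shows "coord p k x mod int (p ^ j) = coord p j x"
proof (cases "finite (prime_exponents w p)")
  case True
  then obtain a where "x = Inl a"
    using x by (auto simp: carrier_G_factor)
  moreover have "int (p ^ j) dvd int (p ^ k)"
    using assms(2) by (simp add: le_imp_power_dvd)
  ultimately show ?thesis
    by (simp add: mod_mod_cancel)
next
  case False
  then obtain f where f: "x = Inr f" "\<And>k. f (Suc k) mod int (p ^ k) = f k"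
      "\<And>k. 0 \<le> f k \<and> f k < int (p ^ k)"
    using x by (auto simp: carrier_G_factor)
  have "f k mod int (p ^ j) = f j"
    using assms(2)
  proof (induction rule: dec_induct)
    case base
    then show ?case
      using f(3)[of j] by simp
  next
    case (step k)
    have "int (p ^ j) dvd int (p ^ k)"
      using step by (simp add: le_imp_power_dvd)
    then show ?case
      using f(2)[of k] step by (metis mod_mod_cancel)
  qed
  then show ?thesis
    by (simp add: f)
qed

text \<open>In a finite factor the top exponent decides. Otherwise the exponents, being downward
  closed and unbounded, are all natural numbers.\<close>

lemma coord_inj:
  assumes "x \<in> carrier (G_factor w p)" "y \<in> carrier (G_factor w p)"
    and "\<And>k. k \<in> prime_exponents w p \<Longrightarrow> coord p k x = coord p k y"
  shows "x = y"
proof (cases "finite (prime_exponents w p)")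
  case True
  then show ?thesis
    using assms(1,2) assms(3)[OF Max_prime_exponents(1)[OF True]]
    by (auto simp: carrier_G_factor)
next
  case False
  then have "k \<in> prime_exponents w p" for k
    using prime_exponents_mono[OF w p] by (metis finite_nat_set_iff_bounded_le nat_le_linear)
  then show ?thesis
    using assms False by (auto simp: carrier_G_factor)
qed

lemma local_residue_in_carrier: "u \<in> betaZ \<Longrightarrow> local_residue w p u \<in> carrier (G_factor w p)"
  using p by (auto simp: local_residue_def carrier_G_factor res_bounds res_mod_dvd)

lemma coord_local_residue:
  assumes "u \<in> betaZ" "k \<in> prime_exponents w p"
  shows "coord p k (local_residue w p u) = res u (int (p ^ k))"
proof (cases "finite (prime_exponents w p)")
  case True
  then show ?thesis
    using res_mod_dvd[OF assms(1) _ Max_prime_exponents(2)[OF True assms(2)]] p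
    by (simp add: local_residue_def)
qed (simp add: local_residue_def)

end

abbreviation local_product :: "int set set \<Rightarrow> (nat \<Rightarrow> int + (nat \<Rightarrow> int)) monoid" where
  "local_product w \<equiv> product_group {p. prime p} (G_factor w)"

text \<open>Each coordinate modulo \<open>p ^ k\<close> of an abstract isomorphism is additive into
  a finite cyclic group, so it vanishes on the infinitely divisible class of \<open>z\<close>. By
  injectivity that class is zero.\<close>

lemma iso_imp_self_divisible:
  assumes w: "w \<in> betaN" and iso: "uf_quotient w \<cong> local_product w"
  shows "self_divisible w"
proof -
  have wZ: "w \<in> betaZ"
    using w by (simp add: betaN_iff betaZ_iff)
  obtain h where h: "h \<in> iso (uf_quotient w) (local_product w)"
    using iso by (auto simp: is_iso_def)
  obtain z where z: "z \<in> betaZ" "(z, principal_uf 0) \<in> res_cong w \<longleftrightarrow> self_divisible w"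
    "\<And>N. 0 < N \<Longrightarrow> \<exists>v\<in>betaZ. (z, uf_mult N v) \<in> res_cong w"
    using infinitely_divisible_element[OF w] by metis
  have h_carrier: "h (uf_class w u) \<in> (\<Pi>\<^sub>E p\<in>{p. prime p}. carrier (G_factor w p))" if "u \<in> betaZ" for u
    using h hom_in_carrier[of h "uf_quotient w" "local_product w" "uf_class w u"]
      uf_class_in_carrier[OF that] by (auto simp: iso_def)
  have h_add: "h (uf_class w (uf_add u v)) p = h (uf_class w u) p \<otimes>\<^bsub>G_factor w p\<^esub> h (uf_class w v) p"
    if "u \<in> betaZ" "v \<in> betaZ" "prime p" for u v p
    using h hom_mult[of h "uf_quotient w" "local_product w" "uf_class w u" "uf_class w v"] that
    by (simp add: iso_def uf_class_in_carrier mult_uf_quotient[OF w])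
  have "h (uf_class w z) p = h (uf_class w (principal_uf 0)) p" if p: "prime p" for p
  proof (rule coord_inj[OF wZ])
    show "0 < p"
      using p by (rule prime_gt_0_nat)
    have G: "h (uf_class w u) p \<in> carrier (G_factor w p)" if "u \<in> betaZ" for u
      using h_carrier[OF that] p by auto
    then show "h (uf_class w z) p \<in> carrier (G_factor w p)"
        "h (uf_class w (principal_uf 0)) p \<in> carrier (G_factor w p)"
      using z(1) principal_in_betaZ by auto
    fix k
    assume k: "k \<in> prime_exponents w p"
    define \<theta> where "\<theta> u = coord p k (h (uf_class w u) p)" for u
    have \<theta>_cong: "\<theta> u = \<theta> v" if "(u, v) \<in> res_cong w" for u v
      using equiv_class_eq[OF equiv_res_cong[OF w] that] by (simp add: \<theta>_def)
    have \<theta>_add: "\<theta> (uf_add u v) = (\<theta> u + \<theta> v) mod int (p ^ k)" if "u \<in> betaZ" "v \<in> betaZ" for u v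
      unfolding \<theta>_def h_add[OF that p]
      using that by (intro coord_mult[OF wZ \<open>0 < p\<close>] G k)
    have \<theta>_bounds: "0 \<le> \<theta> u \<and> \<theta> u < int (p ^ k)" if "u \<in> betaZ" for u
      unfolding \<theta>_def using that by (intro coord_bounds[OF wZ \<open>0 < p\<close>] G)
    show "coord p k (h (uf_class w z) p) = coord p k (h (uf_class w (principal_uf 0)) p)"
      using additive_eq_zero_if_divisible[OF w z(3) \<theta>_cong \<theta>_add \<theta>_bounds] by (simp add: \<theta>_def)
  qed
  then have "h (uf_class w z) = h (uf_class w (principal_uf 0))"
    by (intro PiE_ext[OF h_carrier[OF z(1)] h_carrier[OF principal_in_betaZ]]) simp
  moreover have "inj_on h (carrier (uf_quotient w))"
    using h by (simp add: iso_def bij_betw_def)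
  ultimately have "uf_class w z = uf_class w (principal_uf 0)"
    using uf_class_in_carrier z(1) principal_in_betaZ by (metis inj_onD)
  then show ?thesis
    using z uf_class_eq_iff[OF w] principal_in_betaZ by metis
qed

lemma dvd_if_prime_powers_dvd:
  fixes n x :: int
  assumes n: "0 < n" and pp: "\<And>p k. prime p \<Longrightarrow> int (p ^ k) dvd n \<Longrightarrow> int (p ^ k) dvd x"
  shows "n dvd x"
proof (cases "x = 0")
  case False
  have "nat n dvd nat \<bar>x\<bar>"
  proof (rule multiplicity_le_imp_dvd)
    show "nat n \<noteq> 0"
      using n by simp
    fix p :: nat
    assume p: "prime p"
    have "p ^ multiplicity p (nat n) dvd nat n"
      by (rule multiplicity_dvd)
    then have "int (p ^ multiplicity p (nat n)) dvd n"
      using n by (metis int_dvd_int_iff int_nat_eq order_less_imp_le)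
    then have "int (p ^ multiplicity p (nat n)) dvd \<bar>x\<bar>"
      using pp[OF p] by simp
    then have "p ^ multiplicity p (nat n) dvd nat \<bar>x\<bar>"
      by (metis abs_ge_zero int_dvd_int_iff nat_0_le)
    then show "multiplicity p (nat n) \<le> multiplicity p (nat \<bar>x\<bar>)"
      using False p by (intro multiplicity_geI) auto
  qed
  then show ?thesis
    using n by (metis abs_ge_zero dvd_abs_iff int_dvd_int_iff nat_0_le order_less_imp_le)
qed simp

text \<open>A residue modulo a divisor \<open>n\<close> of \<open>w\<close> is determined modulo the
  prime powers dividing \<open>n\<close>, and these divide \<open>w\<close> as well.\<close>

lemma self_divisible_res_cong_prime_iff:
  assumes w: "w \<in> betaN" and sd: "self_divisible w" and uv: "u \<in> betaZ" "v \<in> betaZ"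
  shows "(u, v) \<in> res_cong w \<longleftrightarrow>
    (\<forall>p k. prime p \<and> k \<in> prime_exponents w p \<longrightarrow> res u (int (p ^ k)) = res v (int (p ^ k)))"
    (is "_ \<longleftrightarrow> ?R")
proof
  have wZ: "w \<in> betaZ"
    using w by (simp add: betaN_iff betaZ_iff)
  have pp: "0 < int (p ^ k)" "k \<in> prime_exponents w p \<longleftrightarrow> res w (int (p ^ k)) = 0"
    if "prime p" for p k
    using prime_gt_0_nat[OF that] prime_exponents_iff[OF wZ] by simp_all
  show ?R if "(u, v) \<in> res_cong w"
    using res_cong_imp_res_eq[OF w that] pp by blast
  assume R: ?R
  have "res u n = res v n" if n: "0 < n" "res w n = 0" for n
  proof -
    have "n dvd res u n - res v n"
    proof (rule dvd_if_prime_powers_dvd[OF n(1)])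
      fix p k
      assume p: "prime p" "int (p ^ k) dvd n"
      then have "k \<in> prime_exponents w p"
        using pp n res_zero_dvd[OF wZ] by blast
      then have "res u (int (p ^ k)) = res v (int (p ^ k))"
        using R p by blast
      then show "int (p ^ k) dvd res u n - res v n"
        using res_mod_dvd[OF uv(1) n(1) p(2)] res_mod_dvd[OF uv(2) n(1) p(2)]
        by (simp add: mod_eq_dvd_iff[symmetric])
    qed
    then show ?thesis
      using res_mod_self[OF uv(1) n(1)] res_mod_self[OF uv(2) n(1)]
      by (simp add: mod_eq_dvd_iff[symmetric])
  qed
  then show "(u, v) \<in> res_cong w"
    using uv by (simp add: self_divisible_res_cong_iff[OF w sd])
qed

text \<open>For each \<open>k\<close>, the Chinese remainder theorem matches \<open>f\<close> at the
  primes up to \<open>k\<close> with exponents up to \<open>k\<close>. A cluster point of the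
  solutions matches it everywhere.\<close>

lemma local_residues_surj:
  assumes w: "w \<in> betaZ" and f: "\<And>p. prime p \<Longrightarrow> f p \<in> carrier (G_factor w p)"
  obtains u where "u \<in> betaZ" "\<And>p. prime p \<Longrightarrow> local_residue w p u = f p"
proof -
  \<comment> \<open>The largest admissible exponent up to \<open>k\<close>; it exists because zero
    is always admissible.\<close>
  define e where "e k p = Max (prime_exponents w p \<inter> {..k})" for k p
  have e_mem: "e k p \<in> prime_exponents w p" for k p
    using Max_in[of "prime_exponents w p \<inter> {..k}"] prime_exponents_zero[OF w, of p]
    by (auto simp: e_def)
  have le_e: "j \<le> e k p" if "j \<in> prime_exponents w p" "j \<le> k" for j k p
    using that by (simp add: e_def)
  have "\<exists>x. \<forall>p\<in>{p. prime p \<and> p \<le> k}.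
      [x = nat (coord p (e k p) (f p))] (mod p ^ e k p)" for k
  proof (rule chinese_remainder_nat)
    show "finite {p. prime p \<and> p \<le> k}"
      by (rule finite_subset[of _ "{..k}"]) auto
    show "\<forall>p\<in>{p. prime p \<and> p \<le> k}. \<forall>q\<in>{p. prime p \<and> p \<le> k}.
        p \<noteq> q \<longrightarrow> coprime (p ^ e k p) (q ^ e k q)"
      by (auto intro: primes_coprime)
  qed
  then obtain x where x: "\<And>k p. prime p \<Longrightarrow> p \<le> k \<Longrightarrow>
      [x k = nat (coord p (e k p) (f p))] (mod p ^ e k p)"
    by (metis (mono_tags, lifting) mem_Collect_eq)
  \<comment> \<open>From \<open>max p j\<close> on, \<open>p\<close> is among the treated primes and
    \<open>j\<close> is at most \<open>e k p\<close>.\<close>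
  have x_mod: "int (x k) mod int (p ^ j) = coord p j (f p)"
    if "prime p" "j \<in> prime_exponents w p" "max p j \<le> k" for p j k
  proof -
    have p: "0 < p"
      using that prime_gt_0_nat by blast
    have "0 \<le> coord p (e k p) (f p)" "coord p (e k p) (f p) < int (p ^ e k p)"
      using coord_bounds[OF w p f[OF that(1)]] by auto
    moreover have "[int (x k) = int (nat (coord p (e k p) (f p)))] (mod int (p ^ e k p))"
      unfolding cong_int_iff using that by (intro x) auto
    ultimately have "int (x k) mod int (p ^ e k p) = coord p (e k p) (f p)"
      by (simp add: cong_def)
    moreover have "int (p ^ j) dvd int (p ^ e k p)"
      using le_e that by (simp add: le_imp_power_dvd)
    ultimately have "int (x k) mod int (p ^ j) = coord p (e k p) (f p) mod int (p ^ j)"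
      by (metis mod_mod_cancel)
    then show ?thesis
      using coord_mod[OF w p f[OF that(1)], of j "e k p"] le_e that by simp
  qed
  obtain u where u: "u \<in> betaZ"
    "\<And>A. eventually (\<lambda>k. int (x k) \<in> A) sequentially \<Longrightarrow> A \<in> u"
    using uf_of_sequence[of "\<lambda>k. int (x k)"] by blast
  have "local_residue w p u = f p" if p: "prime p" for p
  proof (rule coord_inj[OF w prime_gt_0_nat[OF p]])
    show "local_residue w p u \<in> carrier (G_factor w p)"
      using prime_gt_0_nat[OF p] u(1) by (intro local_residue_in_carrier w)
    fix j
    assume j: "j \<in> prime_exponents w p"
    have "{x. x mod int (p ^ j) = coord p j (f p)} \<in> u"
      by (intro u(2) eventually_sequentiallyI[of "max p j"]) (use x_mod[OF p j] in simp)
    then have "res u (int (p ^ j)) = coord p j (f p)"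
      by (rule res_eqI[OF u(1)]) simp
    then show "coord p j (local_residue w p u) = coord p j (f p)"
      using coord_local_residue[OF w prime_gt_0_nat[OF p] u(1) j] by simp
  qed (rule f[OF p])
  with u(1) that show ?thesis
    by blast
qed

lemma local_residue_add:
  assumes w: "w \<in> betaZ" and p: "0 < p" and uv: "u \<in> betaZ" "v \<in> betaZ"
  shows "local_residue w p (uf_add u v) =
    local_residue w p u \<otimes>\<^bsub>G_factor w p\<^esub> local_residue w p v"
proof (cases "finite (prime_exponents w p)")
  case True
  have "res u (int (p ^ k)) \<in> carrier (integer_mod_group (p ^ k))" if "u \<in> betaZ" for u k
    using that p by (simp add: carrier_integer_mod_group res_bounds)
  then show ?thesis
    using True p uv
    by (simp add: local_residue_def G_factor_def image_group_def inv_into_f_f res_add)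
next
  case False
  have "(\<lambda>k. res u (int (p ^ k))) \<in> carrier (padic_group p)" if "u \<in> betaZ" for u
    using local_residue_in_carrier[OF w p that] False
    by (auto simp: local_residue_def G_factor_def image_group_def)
  then have "local_residue w p u \<otimes>\<^bsub>G_factor w p\<^esub> local_residue w p v =
      Inr ((\<lambda>k. res u (int (p ^ k))) \<otimes>\<^bsub>padic_group p\<^esub> (\<lambda>k. res v (int (p ^ k))))"
    using False uv by (simp add: local_residue_def G_factor_def image_group_def inv_into_f_f)
  then show ?thesis
    using False p uv by (simp add: local_residue_def padic_group_def res_add)
qed

text \<open>Under self-divisibility, congruence means equality of all local residues, so these are
  well defined and injective on classes. Surjectivity is \<open>local_residues_surj\<close>.\<close>

lemma self_divisible_imp_iso:
  assumes w: "w \<in> betaN" and sd: "self_divisible w"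
  shows "uf_quotient w \<cong> local_product w"
proof -
  have wZ: "w \<in> betaZ"
    using w by (simp add: betaN_iff betaZ_iff)
  have local_residue_eq_iff: "local_residue w p u = local_residue w p v \<longleftrightarrow>
      (\<forall>k\<in>prime_exponents w p. res u (int (p ^ k)) = res v (int (p ^ k)))"
    if "prime p" "u \<in> betaZ" "v \<in> betaZ" for p u v
    using coord_inj[OF wZ prime_gt_0_nat[OF that(1)], of "local_residue w p u" "local_residue w p v"]
      local_residue_in_carrier[OF wZ prime_gt_0_nat[OF that(1)]]
      coord_local_residue[OF wZ prime_gt_0_nat[OF that(1)]] that by metis
  have cong_iff: "(u, v) \<in> res_cong w \<longleftrightarrow> (\<forall>p. prime p \<longrightarrow> local_residue w p u = local_residue w p v)"
    if "u \<in> betaZ" "v \<in> betaZ" for u v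
    using self_divisible_res_cong_prime_iff[OF w sd that] local_residue_eq_iff that by metis
  define h where "h X = (\<lambda>p\<in>{p. prime p}. local_residue w p (SOME u. u \<in> X))" for X
  have h_class: "h (uf_class w u) = (\<lambda>p\<in>{p. prime p}. local_residue w p u)" if "u \<in> betaZ" for u
  proof -
    have "u \<in> uf_class w u"
      using equiv_class_self[OF equiv_res_cong[OF w] that] .
    then have "(u, SOME v. v \<in> uf_class w u) \<in> res_cong w"
      using someI[of "\<lambda>v. v \<in> uf_class w u" u] by simp
    moreover from this have "(SOME v. v \<in> uf_class w u) \<in> betaZ"
      using res_cong_iff by blast
    ultimately show ?thesis
      unfolding h_def using that cong_iff by (intro restrict_ext) auto
  qed
  have "h \<in> hom (uf_quotient w) (local_product w)"
  proof (rule homI)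
    fix X
    assume "X \<in> carrier (uf_quotient w)"
    then obtain u where u: "u \<in> betaZ" "X = uf_class w u"
      by (rule carrier_uf_quotientE)
    then show "h X \<in> carrier (local_product w)"
      by (simp add: h_class local_residue_in_carrier[OF wZ] prime_gt_0_nat)
    fix Y
    assume "Y \<in> carrier (uf_quotient w)"
    then obtain v where v: "v \<in> betaZ" "Y = uf_class w v"
      by (rule carrier_uf_quotientE)
    have "local_residue w p (uf_add u v) = local_residue w p u \<otimes>\<^bsub>G_factor w p\<^esub> local_residue w p v"
      if p: "prime p" for p
      using prime_gt_0_nat[OF p] u(1) v(1) by (intro local_residue_add wZ)
    then show "h (X \<otimes>\<^bsub>uf_quotient w\<^esub> Y) = h X \<otimes>\<^bsub>local_product w\<^esub> h Y"
      using u v by (simp add: mult_uf_quotient[OF w] h_class uf_add_in_betaZ cong: restrict_cong)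
  qed
  moreover have "inj_on h (carrier (uf_quotient w))"
  proof (rule inj_onI)
    fix X Y
    assume XY: "X \<in> carrier (uf_quotient w)" "Y \<in> carrier (uf_quotient w)" "h X = h Y"
    obtain u v where uv: "u \<in> betaZ" "v \<in> betaZ" "X = uf_class w u" "Y = uf_class w v"
      using XY carrier_uf_quotientE by metis
    have "h (uf_class w u) p = h (uf_class w v) p" for p
      using XY(3) uv by simp
    then have "local_residue w p u = local_residue w p v" if "prime p" for p
      unfolding h_class[OF uv(1)] h_class[OF uv(2)] using that by (metis restrict_apply' mem_Collect_eq)
    then show "X = Y"
      using uv cong_iff uf_class_eq_iff[OF w] by simp
  qed
  moreover have "h ` carrier (uf_quotient w) = carrier (local_product w)"
  proof
    show "h ` carrier (uf_quotient w) \<subseteq> carrier (local_product w)"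
      using \<open>h \<in> hom (uf_quotient w) (local_product w)\<close> by (rule hom_carrier)
    show "carrier (local_product w) \<subseteq> h ` carrier (uf_quotient w)"
    proof
      fix f
      assume f: "f \<in> carrier (local_product w)"
      then have "f p \<in> carrier (G_factor w p)" if "prime p" for p
        using that by auto
      then obtain u where u: "u \<in> betaZ" "\<And>p. prime p \<Longrightarrow> local_residue w p u = f p"
        using local_residues_surj[OF wZ] by metis
      have "h (uf_class w u) = f"
        unfolding h_class[OF u(1)] using u(2) f
        by (intro extensionalityI[of _ "{p. prime p}"]) (auto simp: PiE_def)
      then show "f \<in> h ` carrier (uf_quotient w)"
        using uf_class_in_carrier[OF u(1)] by blast
    qed
  qed
  ultimately have "h \<in> iso (uf_quotient w) (local_product w)"
    by (simp add: iso_def bij_betw_def)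
  then show ?thesis
    by (auto simp: is_iso_def)
qed

section \<open>The quotient topology\<close>

lemma topspace_betaZ: "topspace betaZ_topology = betaZ"
proof -
  have "betaZ = {u \<in> betaZ. UNIV \<in> u}"
    using ultrafilter_UNIV by (auto simp: betaZ_iff)
  then show ?thesis
    unfolding betaZ_topology_def topology_generated_by_topspace by blast
qed

lemma openin_betaZ_basic: "openin betaZ_topology {u \<in> betaZ. A \<in> u}"
  unfolding betaZ_topology_def by (rule topology_generated_by_Basis) blast

text \<open>The generating sets are closed under finite intersections, so they form a base and not
  only a subbase.\<close>

lemma openin_betaZ_base:
  assumes "openin betaZ_topology U" "u \<in> U"
  obtains A where "A \<in> u" "{v \<in> betaZ. A \<in> v} \<subseteq> U"
proof -
  have "generate_topology_on {{u \<in> betaZ. A \<in> u} | A. True} U"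
    using assms(1) by (simp add: betaZ_topology_def openin_topology_generated_by_iff)
  then have "u \<in> U \<longrightarrow> (\<exists>A. A \<in> u \<and> {v \<in> betaZ. A \<in> v} \<subseteq> U)"
  proof induction
    case (Int U V)
    show ?case
    proof
      assume u: "u \<in> U \<inter> V"
      have "u \<in> betaZ"
        using u Int.hyps(1) topology_generated_by_topspace
          openin_subset[of betaZ_topology U] topspace_betaZ
        by (auto simp: betaZ_topology_def openin_topology_generated_by_iff)
      obtain A B where "A \<in> u" "{v \<in> betaZ. A \<in> v} \<subseteq> U" "B \<in> u" "{v \<in> betaZ. B \<in> v} \<subseteq> V"
        using u Int.IH by blast
      then have "A \<inter> B \<in> u" "{v \<in> betaZ. A \<inter> B \<in> v} \<subseteq> U \<inter> V"
        using \<open>u \<in> betaZ\<close> by (auto simp: betaZ_iff ultrafilter_Int_iff)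
      then show "\<exists>A. A \<in> u \<and> {v \<in> betaZ. A \<in> v} \<subseteq> U \<inter> V"
        by blast
    qed
  next
    case (UN K)
    then show ?case
      by blast
  next
    case (Basis S)
    then show ?case
      by blast
  qed simp
  with assms(2) that show ?thesis
    by blast
qed

lemma compact_space_betaZ: "compact_space betaZ_topology"
  unfolding compact_space_alt topspace_betaZ
proof (intro allI impI)
  fix \<U>
  assume open_cover: "Ball \<U> (openin betaZ_topology) \<and> betaZ \<subseteq> \<Union>\<U>"
  \<comment> \<open>The sets whose basic open set lies in one member of the cover. An ultrafilter
    containing all their complements would be uncovered, so finitely many complements have empty
    intersection.\<close>
  define K where "K = {A. \<exists>U\<in>\<U>. {v \<in> betaZ. A \<in> v} \<subseteq> U}"
  have "\<exists>F. finite F \<and> F \<subseteq> uminus ` K \<and> \<Inter>F = {}"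
  proof (rule ccontr)
    assume "\<nexists>F. finite F \<and> F \<subseteq> uminus ` K \<and> \<Inter>F = {}"
    then obtain u where u: "ultrafilter u" "uminus ` K \<subseteq> u"
      using ultrafilter_exists[of "uminus ` K"] by metis
    then obtain U where "U \<in> \<U>" "u \<in> U"
      using open_cover by (auto simp: betaZ_iff)
    then have "openin betaZ_topology U"
      using open_cover by simp
    then obtain A where "A \<in> u" "{v \<in> betaZ. A \<in> v} \<subseteq> U"
      using \<open>u \<in> U\<close> by (rule openin_betaZ_base)
    moreover from this have "A \<in> K"
      using \<open>U \<in> \<U>\<close> by (auto simp: K_def)
    ultimately show False
      using u ultrafilter_Compl_iff[OF u(1), of A] by auto
  qed
  then obtain F where "finite F" "F \<subseteq> uminus ` K" "\<Inter>F = {}"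
    by blast
  then obtain E where E: "finite E" "E \<subseteq> K" "\<Inter>(uminus ` E) = {}"
    by (metis finite_subset_image)
  have "\<forall>A\<in>E. \<exists>U. U \<in> \<U> \<and> {v \<in> betaZ. A \<in> v} \<subseteq> U"
    using E(2) unfolding K_def by blast
  then obtain g where g: "\<forall>A\<in>E. g A \<in> \<U> \<and> {v \<in> betaZ. A \<in> v} \<subseteq> g A"
    by (rule bchoice[THEN exE])
  have "betaZ \<subseteq> \<Union>(g ` E)"
  proof
    fix u
    assume u: "u \<in> betaZ"
    then have uf: "ultrafilter u"
      by (simp add: betaZ_iff)
    have "\<exists>A\<in>E. A \<in> u"
    proof (rule ccontr)
      assume "\<not> (\<exists>A\<in>E. A \<in> u)"
      then have "uminus ` E \<subseteq> u"
        by (auto simp: ultrafilter_Compl_iff[OF uf])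
      then have "\<Inter>(uminus ` E) \<in> u"
        using E(1) uf by (intro ultrafilter_Inter) auto
      then show False
        using ultrafilter_empty[OF uf] unfolding E(3) by blast
    qed
    then show "u \<in> \<Union>(g ` E)"
      using g u by blast
  qed
  then show "\<exists>\<F>. finite \<F> \<and> \<F> \<subseteq> \<U> \<and> betaZ \<subseteq> \<Union>\<F>"
    using E(1) g by (intro exI[of _ "g ` E"]) auto
qed

abbreviation uf_quotient_topology :: "int set set \<Rightarrow> int set set set topology" where
  "uf_quotient_topology w \<equiv> quotient_topology betaZ_topology (res_cong w)"

lemma topspace_uf_quotient: "topspace (uf_quotient_topology w) = carrier (uf_quotient w)"
proof -
  have "{u \<in> betaZ. uf_class w u \<in> betaZ // res_cong w} = betaZ"
    by (auto intro: quotientI)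
  then have "openin (uf_quotient_topology w) (carrier (uf_quotient w))"
    unfolding openin_quotient_topology topspace_betaZ carrier_uf_quotient
    using openin_topspace[of betaZ_topology] by (simp add: topspace_betaZ)
  then have "carrier (uf_quotient w) \<subseteq> topspace (uf_quotient_topology w)"
    by (rule openin_subset)
  moreover have "topspace (uf_quotient_topology w) \<subseteq> carrier (uf_quotient w)"
    using openin_topspace[of "uf_quotient_topology w"]
    by (simp only: openin_quotient_topology topspace_betaZ carrier_uf_quotient)
  ultimately show ?thesis
    by (rule subset_antisym[rotated])
qed

lemma openin_uf_quotient:
  "openin (uf_quotient_topology w) V \<longleftrightarrow>
    V \<subseteq> carrier (uf_quotient w) \<and> openin betaZ_topology {u \<in> betaZ. uf_class w u \<in> V}"
  by (simp add: openin_quotient_topology topspace_betaZ carrier_uf_quotient)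

text \<open>The class of zero is closed in a Hausdorff quotient. It contains the \<open>y k\<close>,
  and hence their cluster point \<open>t\<close>, which has the residues of \<open>z\<close> and so
  the divisors of \<open>w\<close>.\<close>

lemma Hausdorff_imp_self_divisible:
  assumes w: "w \<in> betaN" and Hausdorff: "Hausdorff_space (uf_quotient_topology w)"
  shows "self_divisible w"
proof -
  have wZ: "w \<in> betaZ" and uf: "ultrafilter w"
    using w by (auto simp: betaN_iff betaZ_iff)
  let ?O = "principal_uf (0 :: int)"
  obtain z where z: "z \<in> betaZ" "\<And>n. 0 < n \<Longrightarrow> res z n = 0 \<longleftrightarrow> res w n = 0"
    using same_divisors_exists[OF wZ] by metis
  \<comment> \<open>Factorials serve as moduli because every positive integer divides all
    sufficiently late ones.\<close>
  have "\<exists>y. (y, ?O) \<in> res_cong w \<and> res y (fact k) = res z (fact k)" for k :: nat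
    using same_divisors_approx[OF w z, of "fact k"] by (metis fact_gt_zero)
  then obtain y where y: "\<And>k. (y k, ?O) \<in> res_cong w" "\<And>k::nat. res (y k) (fact k) = res z (fact k)"
    by metis
  then have yZ: "y k \<in> betaZ" for k
    using res_cong_iff by blast
  obtain t where t: "ultrafilter t"
    "\<And>A. eventually (\<lambda>k. A \<in> y k) sequentially \<Longrightarrow> A \<in> t"
    "\<And>A. A \<in> t \<Longrightarrow> \<exists>k. A \<in> y k"
    using ultrafilter_limit[of y] yZ betaZ_iff by metis
  then have tZ: "t \<in> betaZ"
    by (simp add: betaZ_iff)
  have res_t: "res t n = res z n" if n: "0 < n" for n
  proof (rule res_eqI[OF tZ])
    have "{x. x mod n = res z n} \<in> y k" if "nat n \<le> k" for k
    proof -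
      have dvd: "n dvd fact k"
      proof -
        have "int (nat n) dvd int (fact k)"
          using n that by (intro of_nat_dvd_iff[THEN iffD2] dvd_fact) auto
        then show ?thesis
          using n by simp
      qed
      then have "res (y k) n = res z n"
        using res_mod_dvd[OF yZ _ dvd] res_mod_dvd[OF z(1) _ dvd] y(2) by (metis fact_gt_zero)
      then show ?thesis
        using res_mem[OF yZ[of k] n] by simp
    qed
    then show "{x. x mod n = res z n} \<in> t"
      by (rule t(2)[OF eventually_sequentiallyI])
  qed simp
  have "(t, ?O) \<in> res_cong w"
  proof (rule ccontr)
    assume no: "(t, ?O) \<notin> res_cong w"
    let ?V = "carrier (uf_quotient w) - {uf_class w ?O}"
    have "closedin (uf_quotient_topology w) {uf_class w ?O}"
      using Hausdorff by (simp add: closedin_Hausdorff_singleton topspace_uf_quotient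
          uf_class_in_carrier principal_in_betaZ)
    then have "openin (uf_quotient_topology w) ?V"
      by (simp add: closedin_def topspace_uf_quotient)
    then have "openin betaZ_topology {u \<in> betaZ. uf_class w u \<in> ?V}"
      unfolding openin_uf_quotient by blast
    moreover have "t \<in> {u \<in> betaZ. uf_class w u \<in> ?V}"
      using no tZ uf_class_eq_iff[OF w tZ principal_in_betaZ] uf_class_in_carrier by simp
    ultimately obtain A where A: "A \<in> t" "{v \<in> betaZ. A \<in> v} \<subseteq> {u \<in> betaZ. uf_class w u \<in> ?V}"
      by (rule openin_betaZ_base)
    then obtain k where "A \<in> y k"
      using t(3) by blast
    then have "uf_class w (y k) \<noteq> uf_class w ?O"
      using A(2) yZ by blast
    then show False
      using y(1) uf_class_eq_iff[OF w yZ principal_in_betaZ] by blast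
  qed
  then have "{n. 0 < n \<and> res t n = 0} \<in> w"
    by (simp add: res_cong_zero_iff)
  moreover have "{n. 0 < n \<and> res t n = 0} = {n. 0 < n \<and> res w n = 0}"
    using res_t z(2) by auto
  ultimately show ?thesis
    by (simp add: self_divisible_def)
qed

text \<open>By injectivity, the preimage of \<open>C\<close> under \<open>g\<close> is that of
  \<open>e\<close> C\<open>under the composite, and\<close>e \<open>C\<close> is closed.\<close>

lemma continuous_map_if_continuous_closed_inj_comp:
  assumes closed: "closed_map X Y e" and inj: "inj_on e (topspace X)"
    and g: "g \<in> topspace Z \<rightarrow> topspace X" and cont: "continuous_map Z Y (\<lambda>x. e (g x))"
  shows "continuous_map Z X g"
  unfolding continuous_map_closedin
proof (intro conjI allI impI)
  fix C
  assume C: "closedin X C"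
  then have "closedin Y (e ` C)"
    using closed by (simp add: closed_map_def)
  then have "closedin Z {x \<in> topspace Z. e (g x) \<in> e ` C}"
    using cont unfolding continuous_map_closedin by blast
  moreover have "e (g x) \<in> e ` C \<longleftrightarrow> g x \<in> C" if "x \<in> topspace Z" for x
    using inj_on_image_mem_iff[OF inj] g that closedin_subset[OF C] by blast
  ultimately show "closedin Z {x \<in> topspace Z. g x \<in> C}"
    by (metis (mono_tags, lifting) Collect_cong)
qed (rule g)

text \<open>
  For self-divisible \<open>w\<close>, sending a class to its residues modulo the divisors of \<open>w\<close> is an
  injective continuous, hence closed, map into a product of discrete spaces.
\<close>

lemma self_divisible_imp_profinite:
  assumes w: "w \<in> betaN" and sd: "self_divisible w"
  shows "profinite_group (uf_quotient w) (uf_quotient_topology w)"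
proof -
  let ?T = "uf_quotient_topology w" and ?Q = "uf_quotient w"
  define D where "D = {n. 0 < n \<and> res w n = 0}"
  define e where "e X = (\<lambda>n\<in>D. res (SOME u. u \<in> X) n)" for X
  have e_class: "e (uf_class w u) = (\<lambda>n\<in>D. res u n)" if u: "u \<in> betaZ" for u
  proof -
    have "u \<in> uf_class w u"
      using equiv_class_self[OF equiv_res_cong[OF w] u] .
    then have "(u, SOME v. v \<in> uf_class w u) \<in> res_cong w"
      using someI[of "\<lambda>v. v \<in> uf_class w u" u] by simp
    then show ?thesis
      unfolding e_def by (intro restrict_ext) (auto simp: D_def dest: res_cong_imp_res_eq[OF w])
  qed
  let ?Y = "product_topology (\<lambda>n. discrete_topology (UNIV :: int set)) D"
  have inj: "inj_on e (carrier ?Q)"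
  proof (rule inj_onI)
    fix X Y
    assume XY: "X \<in> carrier ?Q" "Y \<in> carrier ?Q" "e X = e Y"
    obtain u v where uv: "u \<in> betaZ" "v \<in> betaZ" "X = uf_class w u" "Y = uf_class w v"
      using XY carrier_uf_quotientE by metis
    have "e (uf_class w u) n = e (uf_class w v) n" for n
      using XY(3) uv by simp
    then have "res u n = res v n" if "n \<in> D" for n
      unfolding e_class[OF uv(1)] e_class[OF uv(2)] using that by (metis restrict_apply')
    then show "X = Y"
      using uv by (simp add: uf_class_eq_iff[OF w] self_divisible_res_cong_iff[OF w sd] D_def)
  qed
  have e_cont: "continuous_map ?T (discrete_topology UNIV) (\<lambda>X. e X n)" if n: "n \<in> D" for n
  proof -
    have "openin ?T {X \<in> carrier ?Q. e X n \<in> U}" for U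
    proof -
      \<comment> \<open>A condition on one residue is membership of a fixed set of integers in
        \<open>u\<close>, so it defines a basic open set.\<close>
      have "res u n \<in> U \<longleftrightarrow> {x. x mod n \<in> U} \<in> u" if u: "u \<in> betaZ" for u
      proof -
        have *: "{x. x mod n = res u n} \<in> u" and "ultrafilter u"
          using n u res_mem by (auto simp: D_def betaZ_iff)
        then have "{x. x mod n \<in> U} \<in> u \<longleftrightarrow> {x. x mod n = res u n \<and> x mod n \<in> U} \<in> u"
          by (simp add: ultrafilter_Collect_conj)
        also have "{x. x mod n = res u n \<and> x mod n \<in> U} = (if res u n \<in> U then {x. x mod n = res u n} else {})"
          by auto
        also have "\<dots> \<in> u \<longleftrightarrow> res u n \<in> U"
          using * ultrafilter_empty[OF \<open>ultrafilter u\<close>] by simp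
        finally show ?thesis
          by simp
      qed
      then have "{u \<in> betaZ. uf_class w u \<in> {X \<in> carrier ?Q. e X n \<in> U}} =
          {u \<in> betaZ. {x. x mod n \<in> U} \<in> u}"
        using n by (auto simp: e_class uf_class_in_carrier)
      then show ?thesis
        using openin_betaZ_basic by (auto simp: openin_uf_quotient)
    qed
    then show ?thesis
      by (simp add: continuous_map_def topspace_uf_quotient)
  qed
  have e_map: "continuous_map ?T ?Y e"
    unfolding continuous_map_componentwise using e_cont by (auto simp: e_def)
  have "Hausdorff_space ?Y"
    by (simp add: Hausdorff_space_product_topology)
  have compact: "compact_space ?T"
  proof -
    have "continuous_map betaZ_topology ?T (uf_class w)"
      by (auto simp: continuous_map_def topspace_betaZ topspace_uf_quotient uf_class_in_carrier
          openin_uf_quotient)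
    then have "compactin ?T (uf_class w ` betaZ)"
      using compact_space_betaZ unfolding compact_space_def topspace_betaZ
      by (rule image_compactin[rotated])
    moreover have "uf_class w ` betaZ = carrier ?Q"
      by (auto simp: carrier_uf_quotient quotient_def)
    ultimately show ?thesis
      by (simp add: compact_space_def topspace_uf_quotient)
  qed
  then have closed: "closed_map ?T ?Y e"
    using T1_Spaces.continuous_imp_closed_map[OF e_map] \<open>Hausdorff_space ?Y\<close> by blast
  \<comment> \<open>Continuity into the quotient can be tested on the residues modulo each divisor
    of \<open>w\<close>; it is applied to both group operations.\<close>
  have into_T: "continuous_map Z ?T g"
    if g: "g \<in> topspace Z \<rightarrow> carrier ?Q"
      and cont: "\<And>n. n \<in> D \<Longrightarrow> continuous_map Z (discrete_topology UNIV) (\<lambda>x. e (g x) n)"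
    for Z :: "'z topology" and g
  proof (rule continuous_map_if_continuous_closed_inj_comp[OF closed])
    show "inj_on e (topspace ?T)"
      using inj by (simp add: topspace_uf_quotient)
    show "g \<in> topspace Z \<rightarrow> topspace ?T"
      using g by (simp add: topspace_uf_quotient)
    show "continuous_map Z ?Y (\<lambda>x. e (g x))"
      unfolding continuous_map_componentwise
      using cont restrict_extensional by (auto simp: e_def)
  qed
  have "topological_group ?Q ?T"
    unfolding topological_group_def
  proof (intro conjI)
    show "group ?Q"
      using w by (rule group_uf_quotient)
    show "topspace ?T = carrier ?Q"
      by (rule topspace_uf_quotient)
    show "continuous_map (prod_topology ?T ?T) ?T (\<lambda>(x, y). x \<otimes>\<^bsub>?Q\<^esub> y)"
    proof (rule into_T)
      show "(\<lambda>(X, Y). X \<otimes>\<^bsub>?Q\<^esub> Y) \<in> topspace (prod_topology ?T ?T) \<rightarrow> carrier ?Q"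
        using group.is_monoid[OF group_uf_quotient[OF w]]
        by (auto simp: topspace_uf_quotient intro: monoid.m_closed)
      fix n
      assume n: "n \<in> D"
      have "discrete_topology (UNIV :: (int \<times> int) set) =
          prod_topology (discrete_topology UNIV) (discrete_topology UNIV)"
        by (metis UNIV_Times_UNIV prod_topology_discrete_topology)
      moreover have "continuous_map (prod_topology ?T ?T) (discrete_topology UNIV) (\<lambda>p. e (fst p) n)"
        using continuous_map_compose[OF continuous_map_fst[of ?T ?T] e_cont[OF n]]
        by (simp add: o_def)
      moreover have "continuous_map (prod_topology ?T ?T) (discrete_topology UNIV) (\<lambda>p. e (snd p) n)"
        using continuous_map_compose[OF continuous_map_snd[of ?T ?T] e_cont[OF n]]
        by (simp add: o_def)
      ultimately have "continuous_map (prod_topology ?T ?T) (discrete_topology UNIV)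
          (\<lambda>p. (e (fst p) n, e (snd p) n))"
        by (simp add: continuous_map_paired)
      then have "continuous_map (prod_topology ?T ?T) (discrete_topology UNIV)
          ((\<lambda>(a, b). (a + b) mod n) \<circ> (\<lambda>p. (e (fst p) n, e (snd p) n)))"
        by (rule continuous_map_compose) simp
      then show "continuous_map (prod_topology ?T ?T) (discrete_topology UNIV)
          (\<lambda>p. e (case p of (X, Y) \<Rightarrow> X \<otimes>\<^bsub>?Q\<^esub> Y) n)"
      proof (rule continuous_map_eq)
        fix p
        assume "p \<in> topspace (prod_topology ?T ?T)"
        then obtain X Y where p: "p = (X, Y)" "X \<in> carrier ?Q" "Y \<in> carrier ?Q"
          by (auto simp: topspace_uf_quotient)
        obtain u v where uv: "u \<in> betaZ" "v \<in> betaZ" "X = uf_class w u" "Y = uf_class w v"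
          using p carrier_uf_quotientE by metis
        then show "((\<lambda>(a, b). (a + b) mod n) \<circ> (\<lambda>p. (e (fst p) n, e (snd p) n))) p =
            e (case p of (X, Y) \<Rightarrow> X \<otimes>\<^bsub>?Q\<^esub> Y) n"
          using n by (simp add: p mult_uf_quotient[OF w] e_class uf_add_in_betaZ res_add D_def)
      qed
    qed
    show "continuous_map ?T ?T (\<lambda>x. inv\<^bsub>?Q\<^esub> x)"
    proof (rule into_T)
      show "(\<lambda>X. inv\<^bsub>?Q\<^esub> X) \<in> topspace ?T \<rightarrow> carrier ?Q"
        using group.inv_closed[OF group_uf_quotient[OF w]] by (simp add: topspace_uf_quotient)
      fix n
      assume n: "n \<in> D"
      have "continuous_map ?T (discrete_topology UNIV) ((\<lambda>a. (- a) mod n) \<circ> (\<lambda>X. e X n))"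
        using e_cont[OF n] by (rule continuous_map_compose) simp
      then show "continuous_map ?T (discrete_topology UNIV) (\<lambda>X. e (inv\<^bsub>?Q\<^esub> X) n)"
      proof (rule continuous_map_eq)
        fix X
        assume "X \<in> topspace ?T"
        then obtain u where u: "u \<in> betaZ" "X = uf_class w u"
          unfolding topspace_uf_quotient by (rule carrier_uf_quotientE)
        then show "((\<lambda>a. (- a) mod n) \<circ> (\<lambda>X. e X n)) X = e (inv\<^bsub>?Q\<^esub> X) n"
          using n by (simp add: inv_uf_quotient[OF w] e_class uf_neg_in_betaZ res_neg D_def)
      qed
    qed
  qed
  moreover have "Hausdorff_space ?T"
    using \<open>Hausdorff_space ?Y\<close> e_map inj
    by (metis Hausdorff_space_injective_preimage topspace_uf_quotient)
  moreover have "totally_disconnected_space ?T"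
    unfolding totally_disconnected_space_def
  proof
    fix C
    assume C: "C \<in> connected_components_of ?T"
    then have conn: "connectedin ?T C"
      by (rule connectedin_connected_components_of)
    then have "C \<subseteq> carrier ?Q"
      using connectedin_subset_topspace topspace_uf_quotient by metis
    obtain X where X: "X \<in> C"
      using nonempty_connected_components_of[OF C] by blast
    have "C \<subseteq> {X}"
    proof
      fix Y
      assume Y: "Y \<in> C"
      \<comment> \<open>A connected set has at most one residue modulo each \<open>n\<close>, since
        its image in a discrete space is connected.\<close>
      have "e Y n = e X n" for n
      proof (cases "n \<in> D")
        case True
        then have "connectedin (discrete_topology UNIV) ((\<lambda>X. e X n) ` C)"
          using connectedin_continuous_map_image[OF e_cont conn] by blast
        then show ?thesis
          using X Y by (auto simp: connectedin_discrete_topology)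
      qed (simp add: e_def)
      then have "e Y = e X"
        by (rule ext)
      then have "Y = X"
        using inj X Y \<open>C \<subseteq> carrier ?Q\<close> by (metis inj_onD subsetD)
      then show "Y \<in> {X}"
        by simp
    qed
    with X have "C = {X}"
      by blast
    then show "\<exists>X. C = {X}"
      by (rule exI)
  qed
  ultimately show ?thesis
    using compact by (simp add: profinite_group_def)
qed

theorem mainTheorem1:
  fixes emb :: "int \<Rightarrow> 's" and star :: "int list set \<Rightarrow> 's list set"
    and w :: "int set set"
  assumes "elementary_extension emb star" and "saturated star"
    and "w \<in> betaN"
  shows "((w, principal_uf 0) \<in> uf_scong star w \<longleftrightarrow>
            equiv betaZ (uf_cong star w)) \<and>
         (equiv betaZ (uf_cong star w) \<longleftrightarrow>
            uf_cong star w = uf_scong star w) \<and>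
         (uf_cong star w = uf_scong star w \<longleftrightarrow>
            quotient_monoid betaZ_monoid (uf_scong star w) \<cong>
              product_group {p. prime p} (G_factor w)) \<and>
         (quotient_monoid betaZ_monoid (uf_scong star w) \<cong>
              product_group {p. prime p} (G_factor w) \<longleftrightarrow>
            profinite_group (quotient_monoid betaZ_monoid (uf_scong star w))
              (quotient_topology betaZ_topology (uf_scong star w)))"
proof -
  note elem = assms(1) and saturated = assms(2) and w = assms(3)
  note scong = uf_scong_eq_res_cong[OF elem saturated w]
  have self_divisible: "(w, principal_uf 0) \<in> uf_scong star w \<longleftrightarrow> self_divisible w"
    unfolding scong by (rule self_divisible_iff[OF w])
  \<comment> \<open>The first three conditions form the cycle (1), (3), (2), (1); each of (4) and
    (5) is equivalent to self-divisibility directly.\<close>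
  have coincide: "uf_cong star w = uf_scong star w" if "self_divisible w"
    using uf_scong_subset_uf_cong[OF elem saturated w]
      self_divisible_uf_cong_subset[OF elem saturated w that] by (rule subset_antisym[rotated])
  have equiv: "equiv betaZ (uf_cong star w)" if "uf_cong star w = uf_scong star w"
    unfolding that scong by (rule equiv_res_cong[OF w])
  have trans: "self_divisible w" if "equiv betaZ (uf_cong star w)"
    using that unfolding equiv_def by (intro uf_cong_trans_imp_self_divisible[OF elem saturated w]) blast
  have iso: "uf_quotient w \<cong> local_product w \<longleftrightarrow> self_divisible w"
    using iso_imp_self_divisible[OF w] self_divisible_imp_iso[OF w] by (rule iffI)
  have profinite: "profinite_group (uf_quotient w) (uf_quotient_topology w) \<longleftrightarrow> self_divisible w"
    using Hausdorff_imp_self_divisible[OF w] self_divisible_imp_profinite[OF w]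
    unfolding profinite_group_def by blast
  show ?thesis
    using self_divisible coincide equiv trans iso profinite unfolding scong by blast
qed

end
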